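(* There is a finite universal constant $c>0$ (not depending on $\mathcal F$ or $P$) such that for all $r_0,\delta\in(0,1)$, $$\max_{r\in(r_0,1)}\mathcal B_{\hat n}\!\left(\left\lceil\tfrac1r\right\rceil,\delta\right)\le c\,\theta(d r_0)\left(d\ln\big(e\,\theta(d r_0)\big)+\ln\left(\frac{\log_2(2/r_0)}{\delta}\right)\right)\log_2\left(\frac{2}{r_0}\right).$$
   Context: Let $\mathcal X$ be an instance space and $\mathcal Y=\{-1,+1\}$. A classifier is a measurable function $h:\mathcal X\to\mathcal Y$. $\mathcal F$ is a set of classifiers with VC dimension $d$, and $P$ is a probability measure on $\mathcal X\times\mathcal Y$. Realizable case: there is a target function $f^*\in\mathcal F$ with $\mathbb P(Y=f^*(x)\mid X=x)=1$ for all $x\in\mathcal X$, where $(X,Y)\sim P$. For a set $\mathcal H$ of classifiers, $\mathrm{DIS}(\mathcal H)=\{x\in\mathcal X:\exists h,g\in\mathcal H,\ h(x)\ne g(x)\}$ and $\Delta\mathcal H=P(\mathrm{DIS}(\mathcal H)\times\mathcal Y)$. Let $(x_1,y_1),(x_2,y_2),\ldots$ be i.i.d. with distribution $P$, $S_m=\{(x_1,y_1),\ldots,(x_m,y_m)\}$, and suppose $y_i=f^*(x_i)$ for all $i$ (true with probability 1). For a finite sample $S$, the version space is $\mathrm{VS}_{\mathcal F,S}=\{h\in\mathcal F:\forall (x,y)\in S,\ h(x)=y\}$. The version space compression set size $\hat n(S)=\hat n(\mathcal F,S)$ is the size of a smallest subset $C\subseteq S$ with $\mathrm{VS}_{\mathcal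 F,C}=\mathrm{VS}_{\mathcal F,S}$. For $m\in\mathbb N\cup\{0\}$, $\delta\in(0,1]$, define $$\mathcal B_{\hat n}(m,\delta)=\min\{b\in\mathbb N\cup\{0\}:\mathbb P(\hat n(S_m)\le b)\ge 1-\delta\}.$$ For a classifier $f$ and $r>0$, $\mathrm B(f,r)=\{h\in\mathcal F:\Delta\{h,f\}\le r\}$. The disagreement coefficient is, for $r_0\ge 0$, $\theta(r_0)=\sup_{r>r_0}\frac{\Delta \mathrm B(f^*,r)}{r}\vee 1$, where $a\vee b=\max\{a,b\}$.
   Formalization: Assumed in addition: DIS(B(f*,r)) is measurable for r>0, and for each labelling of n points the set of n-tuples on which some h in F realizes it is measurable (without this the claim can fail); c is chosen per ambient set of instances, a uniform c follows by disjoint union. *)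

theory Defs
  imports "HOL-Probability.Probability"
begin

abbreviation labels :: "int set" where
  "labels \<equiv> {-1, 1}"

text \<open>
  Throughout, \<open>M\<close> is only used as a measurable space (the instance space). Classifiers are
  functions on the whole type whose values outside \<open>space M\<close> are irrelevant.
\<close>

definition classifiers :: "'a measure \<Rightarrow> ('a \<Rightarrow> int) set" where
  "classifiers M = M \<rightarrow>\<^sub>M count_space labels"

definition shatters :: "('a \<Rightarrow> int) set \<Rightarrow> 'a set \<Rightarrow> bool" where
  "shatters F A \<longleftrightarrow> (\<forall>B\<subseteq>A. \<exists>h\<in>F. \<forall>x\<in>A. h x = (if x \<in> B then 1 else -1))"

definition has_VC_dim :: "'a measure \<Rightarrow> ('a \<Rightarrow> int) set \<Rightarrow> nat \<Rightarrow> bool" where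
  "has_VC_dim M F d \<longleftrightarrow>
     (\<exists>A\<subseteq>space M. finite A \<and> card A = d \<and> shatters F A) \<and>
     (\<forall>A\<subseteq>space M. finite A \<longrightarrow> shatters F A \<longrightarrow> card A \<le> d)"

text \<open>
  The usual regularity condition of VC theory, in a weak form: for each labelling of \<open>n\<close> points,
  the set of \<open>n\<close>-tuples of instances on which some member of \<open>F\<close> realizes it is measurable. It
  holds for countable classes and for pointwise separable ones. Without such a condition
  consistency with a large sample does not force a small error, even for finite VC dimension.
\<close>

definition trace_measurable :: "'a measure \<Rightarrow> ('a \<Rightarrow> int) set \<Rightarrow> bool" where
  "trace_measurable M F \<longleftrightarrow>
     (\<forall>n. \<forall>y\<in>{..<n::nat} \<rightarrow> labels.
        {x \<in> space (\<Pi>\<^sub>M i\<in>{..<n}. M). \<exists>h\<in>F. \<forall>i<n. h (x i) = y i} \<in> sets (\<Pi>\<^sub>M i\<in>{..<n}. M))"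

text \<open>
  \<open>q\<close> is a version of \<open>x \<mapsto> \<P>(E | X = x)\<close>, where \<open>(X, Y)\<close> has distribution \<open>P\<close>.
\<close>

definition cond_prob_version ::
    "'a measure \<Rightarrow> ('a \<times> int) measure \<Rightarrow> ('a \<times> int) set \<Rightarrow> ('a \<Rightarrow> real) \<Rightarrow> bool" where
  "cond_prob_version M P E q \<longleftrightarrow>
     integrable (distr P M fst) q \<and>
     (\<forall>A\<in>sets M. measure P (E \<inter> (A \<times> labels)) = (LINT x:A|distr P M fst. q x))"

definition realizable_by :: "'a measure \<Rightarrow> ('a \<times> int) measure \<Rightarrow> ('a \<Rightarrow> int) \<Rightarrow> bool" where
  "realizable_by M P f \<longleftrightarrow>
     (\<exists>q. cond_prob_version M P {(x, y) \<in> space P. y = f x} q \<and> (\<forall>x\<in>space M. q x = 1))"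

definition DIS :: "'a measure \<Rightarrow> ('a \<Rightarrow> int) set \<Rightarrow> 'a set" where
  "DIS M H = {x \<in> space M. \<exists>h\<in>H. \<exists>g\<in>H. h x \<noteq> g x}"

definition Delta :: "'a measure \<Rightarrow> ('a \<times> int) measure \<Rightarrow> ('a \<Rightarrow> int) set \<Rightarrow> real" where
  "Delta M P H = measure P (DIS M H \<times> labels)"

definition classifier_ball ::
    "'a measure \<Rightarrow> ('a \<times> int) measure \<Rightarrow> ('a \<Rightarrow> int) set \<Rightarrow> ('a \<Rightarrow> int) \<Rightarrow> real \<Rightarrow> ('a \<Rightarrow> int) set" where
  "classifier_ball M P F f r = {h \<in> F. Delta M P {h, f} \<le> r}"

text \<open>
  The supremum is over a set bounded by \<open>1 / r0\<close> if \<open>r0 > 0\<close>. It is meaningless as a real number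
  if \<open>r0 = 0\<close> and the ratios are unbounded.
\<close>

definition disagreement_coeff ::
    "'a measure \<Rightarrow> ('a \<times> int) measure \<Rightarrow> ('a \<Rightarrow> int) set \<Rightarrow> ('a \<Rightarrow> int) \<Rightarrow> real \<Rightarrow> real" where
  "disagreement_coeff M P F f r0 =
     max (SUP r\<in>{r0<..}. Delta M P (classifier_ball M P F f r) / r) 1"

definition VS :: "('a \<Rightarrow> int) set \<Rightarrow> ('a \<times> int) set \<Rightarrow> ('a \<Rightarrow> int) set" where
  "VS F S = {h \<in> F. \<forall>(x, y)\<in>S. h x = y}"

definition nhat :: "('a \<Rightarrow> int) set \<Rightarrow> ('a \<times> int) set \<Rightarrow> nat" where
  "nhat F S = (LEAST n. \<exists>C\<subseteq>S. card C = n \<and> VS F C = VS F S)"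

text \<open>
  The i.i.d. sequence is realized by the coordinates of the infinite product of copies of \<open>P\<close>.
\<close>

definition sample :: "nat \<Rightarrow> (nat \<Rightarrow> 'a \<times> int) \<Rightarrow> ('a \<times> int) set" where
  "sample m \<omega> = \<omega> ` {..<m}"

definition B_nhat :: "('a \<times> int) measure \<Rightarrow> ('a \<Rightarrow> int) set \<Rightarrow> nat \<Rightarrow> real \<Rightarrow> nat" where
  "B_nhat P F m \<delta> =
     (LEAST b. measure (\<Pi>\<^sub>M i\<in>(UNIV :: nat set). P)
        {\<omega> \<in> space (\<Pi>\<^sub>M i\<in>(UNIV :: nat set). P). nhat F (sample m \<omega>) \<le> b} \<ge> 1 - \<delta>)"

end

theory Submission imports Defs "HOL-Library.Discrete_Functions" begin

text \<open>
  The points of a sample that lie in the disagreement region of the version space of their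
  predecessors (those whose labels the CAL algorithm requests) determine the version space, so
  \<open>nhat\<close> is at most their number. If the version space of the first \<open>n\<close> points lies in a ball of
  radius of order \<open>t / n\<close>, where \<open>t = d ln (e \<theta>) + ln (L / \<delta>)\<close> and \<open>L = log\<^sub>2 (2 / r0)\<close>, then
  the disagreement region of that ball has probability of order \<open>\<theta> t / n\<close>. The symmetrization
  argument for \<open>2 n\<close> points, restricted to this region, involves about \<open>\<theta> t\<close> points only; its
  union bound over their traces costs \<open>d ln (\<theta> t / d)\<close>, which is of order \<open>t\<close>, and shows that the
  version space of \<open>2 n\<close> points lies in the ball of half the radius. Summing over the at most \<open>L\<close>
  doublings, an exponential moment bound gives \<open>O(\<theta> t L)\<close> requested labels.
\<close>

section \<open>Traces and compression sets\<close>

text \<open>A symmetrization bound over the whole instance space carries \<open>ln (n / d)\<close>,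
  which grows with the sample; the localized one must know beforehand that the errors lie in a small
  region. This circularity is resolved by induction over the doublings, started at a radius \<ge> 1,
  where membership in the ball is trivial. All regions belong to fixed balls around the target,
  never to the random version space. Hence they are events by hypothesis, hits at different indices
  are independent, and every halving step fails only on a set chosen in advance, without
  conditioning on earlier points. These at most \<open>L\<close> sets have probability at most
  \<open>\<delta> / (2 * L)\<close> each, which is why \<open>t\<close> contains
  \<open>ln (L / \<delta>)\<close>; the other \<open>\<delta> / 2\<close> is spent on the number of
  hits. The radii are \<open>64 * t / 2 ^ k\<close> with \<open>2 ^ k \<le> 1 / r0\<close> and
  \<open>t \<ge> d\<close>, so they stay above \<open>d * r0\<close>, the argument of \<theta>. The
  factor 64 makes the exponent \<open>16 * t\<close> of a halving step beat the
  \<open>d ln (256 e \<theta> t / d)\<close> of its union bound.\<close>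

definition trace_shatters :: "'a set set \<Rightarrow> 'a set \<Rightarrow> bool" where
  "trace_shatters \<E> A \<longleftrightarrow> (\<forall>B\<subseteq>A. \<exists>E\<in>\<E>. E \<inter> A = B)"

text \<open>Pajor's form of the Sauer-Shelah lemma, by splitting the family at one point. Keeping
  the shattered sets themselves, instead of a binomial sum, lets those inside a random set of sample
  points be counted in expectation later.\<close>

lemma card_le_card_trace_shatters:
  assumes "finite X" "\<E> \<subseteq> Pow X"
  shows "card \<E> \<le> card {A. A \<subseteq> X \<and> trace_shatters \<E> A}"
  using assms
proof (induction X arbitrary: \<E> rule: finite_induct)
  case empty
  show ?case
  proof (cases "\<E> = {}")
    case False
    then have "\<E> = {{}}" using empty by auto
    then have "{A. A \<subseteq> {} \<and> trace_shatters \<E> A} = {{}}"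
      by (auto simp: trace_shatters_def)
    then show ?thesis using \<open>\<E> = {{}}\<close> by simp
  qed simp
next
  case (insert x X)
  define E0 where "E0 = {E\<in>\<E>. x \<notin> E}"
  define E1 where "E1 = {E\<in>\<E>. x \<in> E}"
  define R where "R = (\<lambda>E. E - {x}) ` E1"
  let ?S = "\<lambda>G. {A. A \<subseteq> X \<and> trace_shatters G A}"
  let ?T = "{A. A \<subseteq> insert x X \<and> trace_shatters \<E> A}"
  have fin: "finite \<E>" "finite (?S G)" "finite ?T" for G
    using insert.hyps insert.prems by (auto intro: finite_subset[of _ "Pow (insert x X)"])
  have "inj_on (\<lambda>E. E - {x}) E1"
    by (auto simp: inj_on_def E1_def)
  then have cR: "card R = card E1" by (simp add: R_def card_image)
  have "\<E> = E0 \<union> E1" "E0 \<inter> E1 = {}" by (auto simp: E0_def E1_def)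
  then have "card \<E> = card E0 + card E1"
    using fin(1) by (metis card_Un_disjoint finite_Un)
  also have "\<dots> \<le> card (?S E0) + card (?S R)"
    unfolding cR[symmetric]
    by (intro add_mono insert.IH) (use insert.prems in \<open>auto simp: E0_def E1_def R_def\<close>)
  \<comment> \<open>A set shattered by both halves is counted twice; the second count is charged to
    its extension by \<open>x\<close>.\<close>
  also have "\<dots> = card (?S E0 \<union> ?S R) + card (?S E0 \<inter> ?S R)"
    using fin by (intro card_Un_Int) auto
  also have "card (?S E0 \<inter> ?S R) = card (insert x ` (?S E0 \<inter> ?S R))"
    using insert.hyps by (intro card_image[symmetric]) (auto simp: inj_on_def)
  also have "card (?S E0 \<union> ?S R) + card (insert x ` (?S E0 \<inter> ?S R))
      = card ((?S E0 \<union> ?S R) \<union> insert x ` (?S E0 \<inter> ?S R))"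
    using fin insert.hyps by (intro card_Un_disjoint[symmetric]) auto
  also have "\<dots> \<le> card ?T"
  proof (intro card_mono fin, safe)
    fix A assume A: "A \<subseteq> X" "trace_shatters E0 A"
    then show "trace_shatters \<E> A"
      unfolding trace_shatters_def E0_def by blast
  next
    fix A assume A: "A \<subseteq> X" "trace_shatters R A"
    then have "x \<notin> A" using insert.hyps by auto
    show "trace_shatters \<E> A"
      unfolding trace_shatters_def
    proof safe
      fix B assume "B \<subseteq> A"
      then obtain E where "E \<in> E1" "(E - {x}) \<inter> A = B"
        using A unfolding trace_shatters_def R_def by blast
      then show "\<exists>E\<in>\<E>. E \<inter> A = B"
        using \<open>x \<notin> A\<close> by (intro bexI[of _ E]) (auto simp: E1_def)
    qed
  next
    fix A assume A: "A \<subseteq> X" "trace_shatters E0 A" "trace_shatters R A"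
    then have "x \<notin> A" using insert.hyps by auto
    show "trace_shatters \<E> (insert x A)"
      unfolding trace_shatters_def
    proof safe
      fix B assume B: "B \<subseteq> insert x A"
      show "\<exists>E\<in>\<E>. E \<inter> insert x A = B"
      proof (cases "x \<in> B")
        case True
        have "B - {x} \<subseteq> A" using B by auto
        then obtain E where "E \<in> E1" "(E - {x}) \<inter> A = B - {x}"
          using A unfolding trace_shatters_def R_def by blast
        then show ?thesis using True \<open>x \<notin> A\<close>
          by (intro bexI[of _ E]) (auto simp: E1_def)
      next
        case False
        then have "B \<subseteq> A" using B by auto
        then obtain E where "E \<in> E0" "E \<inter> A = B"
          using A unfolding trace_shatters_def by blast
        then show ?thesis using False by (intro bexI[of _ E]) (auto simp: E0_def)
      qed
    qed
  qed auto
  finally show ?case .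
qed

section \<open>Exchanging the halves of a double sample\<close>

definition swap_halves :: "nat \<Rightarrow> nat set \<Rightarrow> nat \<Rightarrow> nat" where
  "swap_halves n \<sigma> i =
     (if i < n \<and> i \<in> \<sigma> then i + n else if n \<le> i \<and> i < 2 * n \<and> i - n \<in> \<sigma> then i - n else i)"

lemma swap_halves_involution: "swap_halves n \<sigma> (swap_halves n \<sigma> i) = i"
  by (auto simp: swap_halves_def)

lemma swap_halves_less: "i < 2 * n \<Longrightarrow> swap_halves n \<sigma> i < 2 * n"
  by (auto simp: swap_halves_def)

text \<open>Each index in \<open>E\<close> decides one position of \<open>\<sigma>\<close>: an index
  of the first half must be exchanged, one of the second half must not. Only
  \<open>n - card E\<close> positions remain free.\<close>

lemma card_swap_halves_avoiding:
  assumes E: "E \<subseteq> {..<2 * n}"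
  shows "card {\<sigma>\<in>Pow {..<n}. \<forall>i<n. swap_halves n \<sigma> i \<notin> E} * 2 ^ card E \<le> 2 ^ n"
proof -
  define V where "V = {\<sigma>\<in>Pow {..<n}. \<forall>i<n. swap_halves n \<sigma> i \<notin> E}"
  define E1 where "E1 = E \<inter> {..<n}"
  define E2 where "E2 = {i. i < n \<and> i + n \<in> E}"
  have E1V: "E1 \<subseteq> \<sigma>" and E2V: "E2 \<inter> \<sigma> = {}" if "\<sigma> \<in> V" for \<sigma>
  proof -
    have av: "\<sigma> \<subseteq> {..<n}" "\<And>i. i < n \<Longrightarrow> swap_halves n \<sigma> i \<notin> E" using that by (auto simp: V_def)
    show "E1 \<subseteq> \<sigma>"
    proof
      fix i assume "i \<in> E1"
      then show "i \<in> \<sigma>" using av(2)[of i] by (auto simp: E1_def swap_halves_def split: if_splits)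
    qed
    show "E2 \<inter> \<sigma> = {}"
      using av by (fastforce simp: E2_def swap_halves_def)
  qed
  have "finite E" using E finite_subset by blast
  show ?thesis
  proof (cases "V = {}")
    case True
    then show ?thesis unfolding V_def[symmetric] by simp
  next
    case False
    \<comment> \<open>If both \<open>i\<close> and \<open>i + n\<close> were in \<open>E\<close>, no
      exchange could move both out of the first half.\<close>
    then have "E1 \<inter> E2 = {}" using E1V E2V by blast
    have "E = E1 \<union> (\<lambda>i. i + n) ` E2"
    proof
      show "E \<subseteq> E1 \<union> (\<lambda>i. i + n) ` E2"
      proof
        fix i assume "i \<in> E"
        show "i \<in> E1 \<union> (\<lambda>i. i + n) ` E2"
        proof (cases "i < n")
          case False
          then have "i - n \<in> E2" "i = (i - n) + n"
            using E \<open>i \<in> E\<close> by (auto simp: E2_def)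
          then show ?thesis by blast
        qed (use \<open>i \<in> E\<close> in \<open>auto simp: E1_def\<close>)
      qed
    qed (auto simp: E1_def E2_def)
    moreover have "E1 \<inter> (\<lambda>i. i + n) ` E2 = {}" by (auto simp: E1_def)
    moreover have f12: "finite E1" "finite E2" by (auto simp: E1_def E2_def)
    moreover have "card ((\<lambda>i. i + n) ` E2) = card E2" by (intro card_image) auto
    ultimately have cE: "card E = card (E1 \<union> E2)"
      using \<open>E1 \<inter> E2 = {}\<close> by (simp add: card_Un_disjoint)
    have "inj_on (\<lambda>\<sigma>. \<sigma> - E1) V"
      using E1V by (auto simp: inj_on_def)
    then have "card V \<le> card (Pow ({..<n} - (E1 \<union> E2)))"
      by (rule card_inj_on_le) (use E2V in \<open>auto simp: V_def\<close>)
    also have "\<dots> = 2 ^ (n - card E)"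
    proof -
      have "card ({..<n} - (E1 \<union> E2)) = n - card (E1 \<union> E2)"
        using f12 by (subst card_Diff_subset) (auto simp: E1_def E2_def)
      then show ?thesis by (simp add: card_Pow cE)
    qed
    finally have "card V * 2 ^ card E \<le> 2 ^ (n - card E) * 2 ^ card E" by simp
    moreover have "card E \<le> n"
      unfolding cE by (rule subset_eq_atLeast0_lessThan_card) (auto simp: E1_def E2_def)
    ultimately show ?thesis
      unfolding V_def by (simp flip: power_add)
  qed
qed

text \<open>The usual bound \<open>(e n / d) ^ d\<close> on a Sauer sum, with \<open>n\<close>
  replaced by a bound \<open>x\<close> on the expected number \<open>n * p\<close> of points in a
  set of probability \<open>p\<close>. The condition \<open>d \<le> x\<close> allows raising
  \<open>(x / d) ^ i\<close> to \<open>(x / d) ^ d\<close>.\<close>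

lemma sum_binomial_power_le:
  fixes p x :: real
  assumes d: "0 < d" and p: "0 \<le> p" and x: "real n * p \<le> x" "real d \<le> x"
  shows "(\<Sum>i\<le>d. real (n choose i) * p ^ i) \<le> (exp 1 * x / d) ^ d"
proof -
  have "real (n choose i) * p ^ i \<le> (x / d) ^ d * (real d ^ i / fact i)" if "i \<le> d" for i
  proof -
    have "real (n choose i) \<le> real n ^ i / fact i"
    proof -
      have "(n choose i) * fact i \<le> n ^ i"
        by (rule binomial_fact_pow)
      then have "real ((n choose i) * fact i) \<le> real (n ^ i)" by (rule of_nat_mono)
      then show ?thesis by (simp add: field_simps)
    qed
    then have "real (n choose i) * p ^ i \<le> real n ^ i / fact i * p ^ i"
      using p by (intro mult_right_mono) auto
    also have "\<dots> = (real n * p) ^ i / fact i" by (simp add: power_mult_distrib)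
    also have "\<dots> \<le> x ^ i / fact i"
      using x p by (intro divide_right_mono power_mono) auto
    also have "\<dots> = (x / d) ^ i * (real d ^ i / fact i)"
      using d by (simp add: power_divide)
    also have "\<dots> \<le> (x / d) ^ d * (real d ^ i / fact i)"
      using that x d by (intro mult_right_mono power_increasing) (auto simp: field_simps)
    finally show ?thesis .
  qed
  then have "(\<Sum>i\<le>d. real (n choose i) * p ^ i) \<le> (\<Sum>i\<le>d. (x / d) ^ d * (real d ^ i / fact i))"
    by (intro sum_mono) auto
  also have "\<dots> = (x / d) ^ d * (\<Sum>i\<le>d. real d ^ i / fact i)"
    by (simp add: sum_distrib_left)
  also have "(\<Sum>i\<le>d. real d ^ i / fact i) \<le> exp (real d)"
    using sum_le_suminf[OF summable_exp_generic[of "real d"], of "{..d}"]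
    by (simp add: exp_def divide_inverse_commute)
  also have "exp (real d) = exp 1 ^ d" by (metis exp_of_nat_mult mult.right_neutral)
  also have "(x / d) ^ d * exp 1 ^ d = (exp 1 * x / d) ^ d"
    by (simp add: power_mult_distrib power_divide field_simps)
  finally show ?thesis using x d by (simp add: mult_left_mono)
qed

section \<open>Version spaces and compression sets\<close>

lemma VS_antimono: "C \<subseteq> S \<Longrightarrow> VS F S \<subseteq> VS F C"
  unfolding VS_def by auto

lemma VS_memD: "h \<in> VS F S \<Longrightarrow> (x, y) \<in> S \<Longrightarrow> h x = y"
  unfolding VS_def by auto

text \<open>The compression set consists of the points whose label is queried by the CAL algorithm,
  with the (possibly non-measurable) region of disagreement of the current version space
  replaced by a fixed superset.\<close>

lemma nhat_le_card_queried:
  fixes x :: "nat \<Rightarrow> 'a"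
  assumes \<omega>: "\<And>i. i < m \<Longrightarrow> \<omega> i = (x i, f (x i))"
    and Q: "\<And>i h. i < m \<Longrightarrow> i \<notin> Q \<Longrightarrow> h \<in> F \<Longrightarrow> (\<And>j. j < i \<Longrightarrow> h (x j) = f (x j)) \<Longrightarrow> h (x i) = f (x i)"
  shows "nhat F (sample m \<omega>) \<le> card (Q \<inter> {..<m})"
proof -
  let ?C = "\<omega> ` (Q \<inter> {..<m})"
  have VS: "VS F ?C = VS F (sample m \<omega>)"
  proof
    show "VS F (sample m \<omega>) \<subseteq> VS F ?C"
      unfolding sample_def by (intro VS_antimono) auto
    show "VS F ?C \<subseteq> VS F (sample m \<omega>)"
    proof
      fix h assume h: "h \<in> VS F ?C"
      have "h (x i) = f (x i)" if "i < m" for i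
        using that
      proof (induction i rule: less_induct)
        case (less i)
        show ?case
        proof (cases "i \<in> Q")
          case True
          then have "(x i, f (x i)) \<in> ?C"
            using less.prems by (intro image_eqI[of _ _ i]) (auto simp: \<omega>)
          then show ?thesis by (rule VS_memD[OF h])
        next
          case False
          then show ?thesis using Q[of i h] less h by (auto simp: VS_def)
        qed
      qed
      then show "h \<in> VS F (sample m \<omega>)"
        using h \<omega> by (auto simp: VS_def sample_def)
    qed
  qed
  have "nhat F (sample m \<omega>) \<le> card ?C"
    unfolding nhat_def using VS by (intro Least_le exI[of _ ?C]) (auto simp: sample_def)
  also have "\<dots> \<le> card (Q \<inter> {..<m})" by (intro card_image_le) auto
  finally show ?thesis .
qed

text \<open>Fixed index sets replace random subsets of the sample, so that the event becomes a
  finite union; repeated sample points are harmless because a subset has an injective choice of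
  indices.\<close>

lemma nhat_le_iff:
  "nhat F (sample m \<omega>) \<le> b \<longleftrightarrow>
     (\<exists>I\<subseteq>{..<m}. card I \<le> b \<and> VS F (\<omega> ` I) = VS F (\<omega> ` {..<m}))"
proof
  let ?R = "\<lambda>n. \<exists>C\<subseteq>sample m \<omega>. card C = n \<and> VS F C = VS F (sample m \<omega>)"
  assume le: "nhat F (sample m \<omega>) \<le> b"
  have "?R (nhat F (sample m \<omega>))"
    unfolding nhat_def by (rule LeastI[of ?R "card (sample m \<omega>)"]) auto
  then obtain C where C: "C \<subseteq> \<omega> ` {..<m}" "card C \<le> b" "VS F C = VS F (\<omega> ` {..<m})"
    using le by (auto simp: sample_def)
  then obtain I where "I \<subseteq> {..<m}" "inj_on \<omega> I" "C = \<omega> ` I"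
    by (auto simp: subset_image_inj)
  then show "\<exists>I\<subseteq>{..<m}. card I \<le> b \<and> VS F (\<omega> ` I) = VS F (\<omega> ` {..<m})"
    using C by (intro exI[of _ I]) (auto simp: card_image)
next
  assume "\<exists>I\<subseteq>{..<m}. card I \<le> b \<and> VS F (\<omega> ` I) = VS F (\<omega> ` {..<m})"
  then obtain I where I: "I \<subseteq> {..<m}" "card I \<le> b" "VS F (\<omega> ` I) = VS F (\<omega> ` {..<m})"
    by auto
  have "nhat F (sample m \<omega>) \<le> card (\<omega> ` I)"
    unfolding nhat_def sample_def using I by (intro Least_le exI[of _ "\<omega> ` I"]) auto
  also have "\<dots> \<le> card I" using I finite_subset by (intro card_image_le) auto
  finally show "nhat F (sample m \<omega>) \<le> b" using I by simp
qed

section \<open>Hits of a product sample\<close>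

context prob_space
begin

lemma product_prob_space_const: "product_prob_space (\<lambda>_. M)"
  by (intro product_prob_spaceI) unfold_locales

text \<open>The generating function of a sum of independent indicators factorizes. It is used with
  \<open>s = 2\<close> for the upper and \<open>s = 1 / 2\<close> for the lower tail.\<close>

lemma integral_power_card_hits:
  fixes s :: real
  assumes I: "finite I" and A: "\<And>i. i \<in> I \<Longrightarrow> A i \<in> events"
  shows "integrable (\<Pi>\<^sub>M i\<in>I. M) (\<lambda>x. s ^ card {i\<in>I. x i \<in> A i})" (is ?int)
    and "(\<integral>x. s ^ card {i\<in>I. x i \<in> A i} \<partial>(\<Pi>\<^sub>M i\<in>I. M)) = (\<Prod>i\<in>I. 1 + (s - 1) * prob (A i))" (is ?eq)
proof -
  interpret Q: product_prob_space "\<lambda>_. M" I by (rule product_prob_space_const)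
  define g where "g i y = 1 + (s - 1) * indicator (A i) y" for i and y :: 'a
  have g: "integrable M (g i)" "integral\<^sup>L M (g i) = 1 + (s - 1) * prob (A i)" if "i \<in> I" for i
    using A[OF that] unfolding g_def by (auto simp: prob_space less_top[symmetric])
  have eq: "s ^ card {i\<in>I. x i \<in> A i} = (\<Prod>i\<in>I. g i (x i))" for x
  proof -
    have "(\<Prod>i\<in>I. g i (x i)) = (\<Prod>i\<in>I. if x i \<in> A i then s else 1)"
      by (intro prod.cong) (auto simp: g_def)
    also have "\<dots> = s ^ card {i\<in>I. x i \<in> A i}"
      using I by (simp add: prod.If_cases Int_def)
    finally show ?thesis ..
  qed
  show ?int unfolding eq by (intro Q.product_integrable_prod I g)
  show ?eq unfolding eq using g by (subst Q.product_integral_prod[OF I]) auto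
qed

lemma hits_measurable:
  assumes "finite I" "\<And>i. i \<in> I \<Longrightarrow> A i \<in> events"
  shows "(\<lambda>x. card {i\<in>I. x i \<in> A i}) \<in> measurable (\<Pi>\<^sub>M i\<in>I. M) (count_space UNIV)"
proof -
  have "(\<lambda>x. \<Sum>i\<in>I. if x i \<in> A i then 1 else 0 :: nat) \<in> measurable (\<Pi>\<^sub>M i\<in>I. M) (count_space UNIV)"
    using assms by measurable
  moreover have "card {i\<in>I. x i \<in> A i} = (\<Sum>i\<in>I. if x i \<in> A i then 1 else 0)" for x
    using assms by (simp add: sum.If_cases Int_def)
  ultimately show ?thesis by simp
qed

text \<open>Markov's inequality for \<open>2 ^ N\<close>, where \<open>N\<close> is the number of
  hits, and \<open>1 + p \<le> exp p\<close>.\<close>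

lemma hits_ge_prob_le:
  assumes I: "finite I" and A: "\<And>i. i \<in> I \<Longrightarrow> A i \<in> events"
  shows "measure (\<Pi>\<^sub>M i\<in>I. M) {x\<in>space (\<Pi>\<^sub>M i\<in>I. M). a \<le> real (card {i\<in>I. x i \<in> A i})}
     \<le> 2 powr - a * exp (\<Sum>i\<in>I. prob (A i))"
proof -
  interpret Q: product_prob_space "\<lambda>_. M" I by (rule product_prob_space_const)
  let ?Q = "\<Pi>\<^sub>M i\<in>I. M" and ?N = "\<lambda>x. card {i\<in>I. x i \<in> A i}"
  let ?W = "{x\<in>space ?Q. a \<le> real (?N x)}"
  note hits_measurable[OF assms, measurable]
  have "measure ?Q ?W = (\<integral>x. indicator ?W x \<partial>?Q)" by simp
  also have "\<dots> \<le> (\<integral>x. 2 powr - a * 2 ^ ?N x \<partial>?Q)"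
  proof (rule integral_mono)
    show "indicator ?W x \<le> 2 powr - a * (2::real) ^ ?N x" for x
    proof (cases "x \<in> ?W")
      case True
      have "1 \<le> 2 powr (real (?N x) - a)"
        using True by (intro ge_one_powr_ge_zero) auto
      also have "\<dots> = 2 powr - a * 2 ^ ?N x"
        by (simp add: powr_diff powr_minus powr_realpow field_simps)
      finally show ?thesis using True by simp
    qed auto
  qed (use integral_power_card_hits(1)[OF assms] in \<open>auto simp: less_top[symmetric]\<close>)
  also have "\<dots> = 2 powr - a * (\<Prod>i\<in>I. 1 + prob (A i))"
    using integral_power_card_hits(2)[where s=2, OF assms] by simp
  also have "\<dots> \<le> 2 powr - a * (\<Prod>i\<in>I. exp (prob (A i)))"
    by (intro mult_left_mono prod_mono) (auto simp: add_nonneg_nonneg)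
  finally show ?thesis using I by (simp add: exp_sum)
qed

text \<open>Markov's inequality for \<open>(1 / 2) ^ N\<close>, where \<open>N\<close> is the number
  of hits, and \<open>1 - p / 2 \<le> exp (- p / 2)\<close>.\<close>

lemma hits_less_prob_le:
  assumes I: "finite I" and A: "\<And>i. i \<in> I \<Longrightarrow> A i \<in> events"
  shows "measure (\<Pi>\<^sub>M i\<in>I. M) {x\<in>space (\<Pi>\<^sub>M i\<in>I. M). real (card {i\<in>I. x i \<in> A i}) < a}
     \<le> 2 powr a * exp (- (\<Sum>i\<in>I. prob (A i)) / 2)"
proof -
  interpret Q: product_prob_space "\<lambda>_. M" I by (rule product_prob_space_const)
  let ?Q = "\<Pi>\<^sub>M i\<in>I. M" and ?N = "\<lambda>x. card {i\<in>I. x i \<in> A i}"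
  let ?W = "{x\<in>space ?Q. real (?N x) < a}"
  note hits_measurable[OF assms, measurable]
  have "measure ?Q ?W = (\<integral>x. indicator ?W x \<partial>?Q)" by simp
  also have "\<dots> \<le> (\<integral>x. 2 powr a * (1/2) ^ ?N x \<partial>?Q)"
  proof (rule integral_mono)
    show "indicator ?W x \<le> 2 powr a * (1/2::real) ^ ?N x" for x
    proof (cases "x \<in> ?W")
      case True
      have "1 \<le> 2 powr (a - real (?N x))"
        using True by (intro ge_one_powr_ge_zero) auto
      also have "\<dots> = 2 powr a * (1/2) ^ ?N x"
        by (simp add: powr_diff powr_realpow power_divide)
      finally show ?thesis using True by simp
    qed auto
  qed (use integral_power_card_hits(1)[OF assms] in \<open>auto simp: less_top[symmetric]\<close>)
  also have "\<dots> = 2 powr a * (\<Prod>i\<in>I. 1 - prob (A i) / 2)"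
    using integral_power_card_hits(2)[where s="1/2", OF assms] by simp
  also have "\<dots> \<le> 2 powr a * (\<Prod>i\<in>I. exp (- prob (A i) / 2))"
  proof (intro mult_left_mono prod_mono conjI)
    fix i
    show "0 \<le> 1 - prob (A i) / 2" using prob_le_1[of "A i"] by linarith
    show "1 - prob (A i) / 2 \<le> exp (- prob (A i) / 2)"
      using exp_ge_add_one_self[of "- prob (A i) / 2"] by simp
  qed auto
  also have "(\<Prod>i\<in>I. exp (- prob (A i) / 2)) = exp (- (\<Sum>i\<in>I. prob (A i)) / 2)"
    using I by (simp add: exp_sum[symmetric] sum_negf sum_divide_distrib)
  finally show ?thesis .
qed

text \<open>By independence a fixed index set \<open>A\<close> has all its points in
  \<open>D\<close> with probability \<open>prob D ^ card A\<close>. This is where localization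
  replaces \<open>n\<close> by \<open>n * prob D\<close>.\<close>

lemma integral_card_small_subsets:
  fixes n d :: nat
  assumes D: "D \<in> events"
  defines "N \<equiv> \<lambda>x. real (card {A\<in>Pow {..<n}. card A \<le> d \<and> (\<forall>i\<in>A. x i \<in> D)})"
  shows "integrable (\<Pi>\<^sub>M i\<in>{..<n}. M) N" (is ?int)
    and "(\<integral>x. N x \<partial>(\<Pi>\<^sub>M i\<in>{..<n}. M)) = (\<Sum>i\<le>d. real (n choose i) * prob D ^ i)" (is ?eq)
proof -
  interpret Q: product_prob_space "\<lambda>_. M" "{..<n}" by (rule product_prob_space_const)
  define S where "S = {A\<in>Pow {..<n}. card A \<le> d}"
  have finS: "finite S" by (auto simp: S_def)
  define g where "g A i y = (if i \<in> A then indicator D y else 1 :: real)" for A :: "nat set" and i and y :: 'a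
  have g: "integrable M (g A i)" "integral\<^sup>L M (g A i) = (if i \<in> A then prob D else 1)" for A i
    using D unfolding g_def by (cases "i \<in> A"; simp add: prob_space less_top[symmetric])+
  have N: "N = (\<lambda>x. \<Sum>A\<in>S. \<Prod>i<n. g A i (x i))"
  proof
    fix x
    have "(\<Prod>i<n. g A i (x i)) = (if \<forall>i\<in>A. x i \<in> D then 1 else 0)" if "A \<in> S" for A
    proof (cases "\<forall>i\<in>A. x i \<in> D")
      case True
      then show ?thesis by (auto intro!: prod.neutral simp: g_def)
    next
      case False
      then obtain i where "i \<in> A" "x i \<notin> D" by auto
      then show ?thesis using that
        by (subst prod_zero) (auto simp: S_def g_def intro!: bexI[of _ i])
    qed
    then have "(\<Sum>A\<in>S. \<Prod>i<n. g A i (x i)) = (\<Sum>A\<in>S. if \<forall>i\<in>A. x i \<in> D then 1 else 0)"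
      by simp
    also have "\<dots> = N x"
      using finS by (simp add: sum.If_cases N_def S_def Int_def conj_ac)
    finally show "N x = (\<Sum>A\<in>S. \<Prod>i<n. g A i (x i))" ..
  qed
  show ?int unfolding N by (intro Bochner_Integration.integrable_sum Q.product_integrable_prod g) auto
  have "(\<integral>x. N x \<partial>(\<Pi>\<^sub>M i\<in>{..<n}. M)) = (\<Sum>A\<in>S. \<Prod>i<n. integral\<^sup>L M (g A i))"
    unfolding N
    by (subst Bochner_Integration.integral_sum)
       (auto intro!: Q.product_integrable_prod g sum.cong Q.product_integral_prod)
  also have "\<dots> = (\<Sum>A\<in>S. prob D ^ card A)"
  proof (intro sum.cong refl)
    fix A assume "A \<in> S"
    then have "{..<n} \<inter> A = A" by (auto simp: S_def)
    then show "(\<Prod>i<n. integral\<^sup>L M (g A i)) = prob D ^ card A"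
      by (simp add: g prod.If_cases)
  qed
  also have "\<dots> = (\<Sum>j\<le>d. \<Sum>A | A \<in> S \<and> card A = j. prob D ^ card A)"
    using finS by (intro sum.group[symmetric]) (auto simp: S_def)
  also have "\<dots> = (\<Sum>j\<le>d. real (n choose j) * prob D ^ j)"
  proof (intro sum.cong refl)
    fix j assume "j \<in> {..d}"
    then have "{A. A \<in> S \<and> card A = j} = {A. A \<subseteq> {..<n} \<and> card A = j}"
      by (auto simp: S_def)
    then show "(\<Sum>A | A \<in> S \<and> card A = j. prob D ^ card A) = real (n choose j) * prob D ^ j"
      using n_subsets[of "{..<n}" j] by simp
  qed
  finally show ?eq .
qed

end

section \<open>Localized symmetrization\<close>

lemma classifier_in_labels: "h \<in> classifiers M \<Longrightarrow> x \<in> space M \<Longrightarrow> h x \<in> labels"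
  unfolding classifiers_def by (auto dest: measurable_space)

text \<open>\<open>M\<close> stands for the instance marginal and is instantiated with
  \<open>distr P M fst\<close>: labels are almost surely those of \<open>f\<close>, so samples here
  consist of instances only.\<close>

locale vc_class = prob_space M for M :: "'a measure" +
  fixes F :: "('a \<Rightarrow> int) set" and f :: "'a \<Rightarrow> int" and d :: nat
  assumes F_classifiers: "F \<subseteq> classifiers M"
    and f_in_F: "f \<in> F"
    and trace_meas: "trace_measurable M F"
    and shatters_card: "A \<subseteq> space M \<Longrightarrow> finite A \<Longrightarrow> shatters F A \<Longrightarrow> card A \<le> d"
begin

abbreviation errors :: "('a \<Rightarrow> int) \<Rightarrow> 'a set" where
  "errors h \<equiv> {x\<in>space M. h x \<noteq> f x}"

abbreviation power_space :: "nat \<Rightarrow> (nat \<Rightarrow> 'a) measure" where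
  "power_space n \<equiv> \<Pi>\<^sub>M i\<in>{..<n}. M"

lemma power_space_component: "x \<in> space (power_space n) \<Longrightarrow> i < n \<Longrightarrow> x i \<in> space M"
  by (auto simp: space_PiM)

lemma label_set: "h \<in> F \<Longrightarrow> {x\<in>space M. h x = y} \<in> events"
proof -
  assume "h \<in> F"
  then have h: "h \<in> measurable M (count_space labels)"
    using F_classifiers by (auto simp: classifiers_def)
  show ?thesis
  proof (cases "y \<in> labels")
    case True
    have "h -` {y} \<inter> space M \<in> events" using True by (intro measurable_sets[OF h]) auto
    then show ?thesis by (simp add: vimage_def Int_def conj_commute)
  next
    case False
    then have "{x\<in>space M. h x = y} = {}" using measurable_space[OF h] by auto
    then show ?thesis by (metis sets.empty_sets)
  qed
qed

lemma F_in_labels: "h \<in> F \<Longrightarrow> x \<in> space M \<Longrightarrow> h x \<in> labels"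
  using classifier_in_labels F_classifiers by (metis subsetD)

lemma errors_measurable: "h \<in> F \<Longrightarrow> errors h \<in> events"
proof -
  assume h: "h \<in> F"
  have "errors h = (\<Union>y\<in>labels. {x\<in>space M. h x = y} - {x\<in>space M. f x = y})"
    using F_in_labels[OF h] by fastforce
  also have "\<dots> \<in> events"
    using label_set[OF h] label_set[OF f_in_F] by (intro sets.finite_UN) auto
  finally show ?thesis .
qed

text \<open>Traces are recorded relative to \<open>f\<close>, as sets of misclassified indices:
  consistency with a part of the sample is then disjointness from it, and localization to
  \<open>D\<close> concerns the members of the trace.\<close>

definition error_traces :: "nat \<Rightarrow> (nat \<Rightarrow> 'a) \<Rightarrow> nat set set" where
  "error_traces n x = {E. E \<subseteq> {..<n} \<and> (\<exists>h\<in>F. \<forall>i<n. h (x i) \<noteq> f (x i) \<longleftrightarrow> i \<in> E)}"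

text \<open>The labels of \<open>f\<close> vary with the sample. Once they are fixed to
  \<open>y\<close>, having trace \<open>E\<close> means realizing \<open>y\<close> flipped on
  \<open>E\<close>, to which \<open>trace_measurable\<close> applies.\<close>

lemma error_trace_measurable:
  assumes E: "E \<subseteq> {..<n}"
  shows "{x\<in>space (power_space n). E \<in> error_traces n x} \<in> sets (power_space n)"
proof -
  let ?Y = "\<Pi>\<^sub>E i\<in>{..<n}. labels"
  let ?y' = "\<lambda>y i. if i \<in> E then - y i else y i :: int"
  let ?A = "\<lambda>y. {x\<in>space (power_space n). \<forall>i\<in>{..<n}. x i \<in> {z\<in>space M. f z = y i}}"
  let ?B = "\<lambda>y. {x\<in>space (power_space n). \<exists>h\<in>F. \<forall>i<n. h (x i) = ?y' y i}"
  have "{x\<in>space (power_space n). E \<in> error_traces n x} = (\<Union>y\<in>?Y. ?A y \<inter> ?B y)"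
  proof safe
    fix x assume x: "x \<in> space (power_space n)" and "E \<in> error_traces n x"
    then obtain h where h: "h \<in> F" "\<And>i. i < n \<Longrightarrow> h (x i) \<noteq> f (x i) \<longleftrightarrow> i \<in> E"
      by (auto simp: error_traces_def)
    define y where "y = (\<lambda>i\<in>{..<n}. f (x i))"
    have lab: "g (x i) \<in> labels" if "i < n" "g \<in> F" for i g
      using F_in_labels[OF that(2) power_space_component[OF x that(1)]] .
    have "y \<in> ?Y" using lab f_in_F by (auto simp: y_def)
    moreover have "x \<in> ?A y" using x power_space_component[OF x] by (auto simp: y_def)
    moreover have "h (x i) = ?y' y i" if "i < n" for i
      using lab[OF that h(1)] lab[OF that f_in_F] h(2)[OF that] that by (auto simp: y_def)
    then have "x \<in> ?B y" using x h(1) by blast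
    ultimately show "x \<in> (\<Union>y\<in>?Y. ?A y \<inter> ?B y)" by blast
  next
    fix x y h assume x: "x \<in> space (power_space n)" and y: "y \<in> ?Y"
      and fy: "\<forall>i\<in>{..<n}. x i \<in> {z\<in>space M. f z = y i}"
      and h: "h \<in> F" "\<forall>i<n. h (x i) = ?y' y i"
    have "h (x i) \<noteq> f (x i) \<longleftrightarrow> i \<in> E" if "i < n" for i
      using that fy h(2) PiE_mem[OF y, of i] by auto
    then show "E \<in> error_traces n x" using h(1) E by (auto simp: error_traces_def)
  qed
  also have "\<dots> \<in> sets (power_space n)"
  proof (intro sets.finite_UN sets.Int finite_PiE)
    fix y assume y: "y \<in> ?Y"
    have "?y' y \<in> {..<n} \<rightarrow> labels" using PiE_mem[OF y] by fastforce
    then show "?B y \<in> sets (power_space n)"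
      by (rule trace_meas[unfolded trace_measurable_def, rule_format])
    have "(\<lambda>x. x i) -` {z\<in>space M. f z = y i} \<inter> space (power_space n) \<in> sets (power_space n)"
      if "i \<in> {..<n}" for i
      using that label_set[OF f_in_F] by measurable
    then show "?A y \<in> sets (power_space n)"
      by (intro sets.sets_Collect_finite_All) (auto simp: vimage_def Int_def conj_commute)
  qed auto
  finally show ?thesis .
qed

lemma card_error_traces_le:
  assumes x: "x \<in> space (power_space n)"
  shows "card {E\<in>error_traces n x. \<forall>i\<in>E. x i \<in> D}
    \<le> card {A\<in>Pow {..<n}. card A \<le> d \<and> (\<forall>i\<in>A. x i \<in> D)}"
proof -
  let ?X = "{i. i < n \<and> x i \<in> D}" and ?\<E> = "{E\<in>error_traces n x. \<forall>i\<in>E. x i \<in> D}"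
  have "card A \<le> d" if A: "A \<subseteq> ?X" "trace_shatters ?\<E> A" for A
  proof -
    have finA: "finite A" by (rule finite_subset[OF A(1)]) auto
    \<comment> \<open>Equal points are misclassified together, so indices carrying the same point
      cannot be separated by traces.\<close>
    have inj: "inj_on x A"
    proof (rule inj_onI, rule ccontr)
      fix i j assume ij: "i \<in> A" "j \<in> A" "x i = x j" "i \<noteq> j"
      have "{i} \<subseteq> A" using ij by auto
      then obtain E where "E \<in> error_traces n x" "E \<inter> A = {i}"
        using A(2)[unfolded trace_shatters_def, rule_format, OF \<open>{i} \<subseteq> A\<close>] by blast
      moreover have "i < n" "j < n" using A(1) ij by auto
      ultimately have "i \<in> E \<longleftrightarrow> j \<in> E"
        using ij(3) unfolding error_traces_def by (smt (verit) mem_Collect_eq)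
      moreover have "i \<in> E" "j \<notin> E" using \<open>E \<inter> A = {i}\<close> ij by auto
      ultimately show False by blast
    qed
    have "shatters F (x ` A)"
      unfolding shatters_def
    proof safe
      fix B assume "B \<subseteq> x ` A"
      \<comment> \<open>To label exactly \<open>B\<close> with 1, a classifier must err precisely
        where \<open>f\<close> disagrees with that labelling.\<close>
      define E0 where "E0 = {i\<in>A. x i \<in> B \<longleftrightarrow> f (x i) \<noteq> 1}"
      have "E0 \<subseteq> A" by (auto simp: E0_def)
      then obtain E where E: "E \<in> error_traces n x" "E \<inter> A = E0"
        using A(2)[unfolded trace_shatters_def, rule_format, OF \<open>E0 \<subseteq> A\<close>] by blast
      then obtain h where h: "h \<in> F" "\<And>i. i < n \<Longrightarrow> h (x i) \<noteq> f (x i) \<longleftrightarrow> i \<in> E"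
        by (auto simp: error_traces_def)
      have "h (x i) = (if x i \<in> B then 1 else - 1)" if "i \<in> A" for i
      proof -
        have "i < n" using that A(1) by auto
        then have "h (x i) \<in> labels" "f (x i) \<in> labels"
          using F_in_labels power_space_component[OF x] h(1) f_in_F by metis+
        moreover have "h (x i) \<noteq> f (x i) \<longleftrightarrow> i \<in> E0" using h(2)[OF \<open>i < n\<close>] that E(2) by auto
        ultimately show ?thesis using that by (auto simp: E0_def)
      qed
      then show "\<exists>h\<in>F. \<forall>z\<in>x ` A. h z = (if z \<in> B then 1 else - 1)" using h(1) by blast
    qed
    moreover have "x ` A \<subseteq> space M" using A(1) x power_space_component by auto
    ultimately have "card (x ` A) \<le> d" using finA by (intro shatters_card) auto
    then show ?thesis by (simp add: card_image[OF inj])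
  qed
  then have "{A. A \<subseteq> ?X \<and> trace_shatters ?\<E> A} \<subseteq> {A\<in>Pow {..<n}. card A \<le> d \<and> (\<forall>i\<in>A. x i \<in> D)}"
    by auto
  then have "card {A. A \<subseteq> ?X \<and> trace_shatters ?\<E> A}
      \<le> card {A\<in>Pow {..<n}. card A \<le> d \<and> (\<forall>i\<in>A. x i \<in> D)}"
    by (intro card_mono) auto
  moreover have "card ?\<E> \<le> card {A. A \<subseteq> ?X \<and> trace_shatters ?\<E> A}"
    by (intro card_le_card_trace_shatters) (auto simp: error_traces_def)
  ultimately show ?thesis by linarith
qed

text \<open>The condition on \<open>D\<close> is imposed on the misclassified sample points and not
  on all errors of a classifier. The event thus depends on traces only and is a finite union of
  measurable sets.\<close>

definition ghost_event :: "nat \<Rightarrow> 'a set \<Rightarrow> nat \<Rightarrow> (nat \<Rightarrow> 'a) set" where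
  "ghost_event n D k = {x\<in>space (power_space (2 * n)). \<exists>E\<in>error_traces (2 * n) x.
     E \<inter> {..<n} = {} \<and> (\<forall>i\<in>E. x i \<in> D) \<and> k \<le> card E}"

lemma ghost_event_measurable:
  assumes D: "D \<in> events"
  shows "ghost_event n D k \<in> sets (power_space (2 * n))"
proof -
  let ?S = "power_space (2 * n)"
  have "ghost_event n D k = (\<Union>E\<in>{E\<in>Pow {..<2 * n}. E \<inter> {..<n} = {} \<and> k \<le> card E}.
     {x\<in>space ?S. E \<in> error_traces (2 * n) x} \<inter> {x\<in>space ?S. \<forall>i\<in>E. x i \<in> D})"
    by (auto simp: ghost_event_def error_traces_def)
  also have "\<dots> \<in> sets ?S"
  proof (intro sets.finite_UN sets.Int error_trace_measurable)
    fix E assume E: "E \<in> {E\<in>Pow {..<2 * n}. E \<inter> {..<n} = {} \<and> k \<le> card E}"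
    then have "(\<lambda>x. x i) -` D \<inter> space ?S \<in> sets ?S" if "i \<in> E" for i
      using that by (intro measurable_sets[OF measurable_component_singleton[of _ _ "\<lambda>_. M"] D]) auto
    then show "{x\<in>space ?S. \<forall>i\<in>E. x i \<in> D} \<in> sets ?S"
      using E by (intro sets.sets_Collect_finite_All)
        (auto simp: vimage_def Int_def conj_commute intro: finite_subset)
  qed auto
  finally show ?thesis .
qed

text \<open>Exchanging the two halves of the sample at a random set \<open>\<sigma>\<close> of positions leaves its
  distribution unchanged, and puts all of at least \<open>k\<close> errors into the second half with
  conditional probability at most \<open>2\<^sup>-\<^sup>k\<close>.\<close>

lemma ghost_event_prob_le:
  assumes D: "D \<in> events"
  shows "measure (power_space (2 * n)) (ghost_event n D k)
    \<le> (\<Sum>i\<le>d. real (2 * n choose i) * prob D ^ i) / 2 ^ k"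
proof -
  let ?Q = "power_space (2 * n)" and ?B = "ghost_event n D k"
  define T where "T \<sigma> x = (\<lambda>i\<in>{..<2 * n}. x (swap_halves n \<sigma> i))" for \<sigma> and x :: "nat \<Rightarrow> 'a"
  interpret Q: product_prob_space "\<lambda>_. M" "{..<2 * n}" by (rule product_prob_space_const)
  have bij: "inj_on (swap_halves n \<sigma>) {..<2 * n}" for \<sigma>
    by (metis inj_onI swap_halves_involution)
  have T: "distr ?Q ?Q (T \<sigma>) = ?Q" for \<sigma>
    unfolding T_def using distr_PiM_reindex[of "{..<2 * n}" "\<lambda>_. M" "swap_halves n \<sigma>" "{..<2 * n}"]
      bij[of \<sigma>] swap_halves_less prob_space_axioms by auto
  have Tm[measurable]: "T \<sigma> \<in> measurable ?Q ?Q" for \<sigma>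
    unfolding T_def by (intro measurable_restrict measurable_component_singleton) (auto simp: swap_halves_less)
  note ghost_event_measurable[OF D, of n k, measurable]
  let ?N = "\<lambda>x. real (card {A\<in>Pow {..<2 * n}. card A \<le> d \<and> (\<forall>i\<in>A. x i \<in> D)})"
  \<comment> \<open>For a fixed sample the exchanges are counted by a union bound: each trace of at
    least \<open>k\<close> errors accounts for at most \<open>2 ^ n / 2 ^ k\<close> of them, and at
    most \<open>?N x\<close> traces stay inside \<open>D\<close>.\<close>
  have pointwise: "(\<Sum>\<sigma>\<in>Pow {..<n}. indicator ?B (T \<sigma> x)) \<le> 2 ^ n / 2 ^ k * ?N x"
    if x: "x \<in> space ?Q" for x
  proof -
    let ?\<E> = "{E\<in>error_traces (2 * n) x. \<forall>i\<in>E. x i \<in> D}"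
    let ?V = "\<lambda>E. {\<sigma>\<in>Pow {..<n}. \<forall>i<n. swap_halves n \<sigma> i \<notin> E}"
    let ?\<E>k = "{E\<in>?\<E>. k \<le> card E}"
    have fin: "finite ?\<E>"
      by (rule finite_subset[of _ "Pow {..<2 * n}"]) (auto simp: error_traces_def)
    then have fink: "finite ?\<E>k" by (rule rev_finite_subset) auto
    \<comment> \<open>Undoing the exchange carries a trace of \<open>T \<sigma> x\<close> to a trace
      of \<open>x\<close>, so all exchanges are charged to traces of the same sample.\<close>
    have sub: "{\<sigma>\<in>Pow {..<n}. T \<sigma> x \<in> ?B} \<subseteq> (\<Union>E\<in>?\<E>k. ?V E)"
    proof safe
      fix \<sigma> assume \<sigma>: "\<sigma> \<subseteq> {..<n}" "T \<sigma> x \<in> ?B"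
      let ?s = "swap_halves n \<sigma>"
      obtain E h where E: "E \<inter> {..<n} = {}" "\<And>i. i \<in> E \<Longrightarrow> T \<sigma> x i \<in> D" "k \<le> card E" "E \<subseteq> {..<2 * n}"
        and h: "h \<in> F" "\<And>i. i < 2 * n \<Longrightarrow> h (T \<sigma> x i) \<noteq> f (T \<sigma> x i) \<longleftrightarrow> i \<in> E"
        using \<sigma>(2) unfolding ghost_event_def error_traces_def by blast
      have "h (x i) \<noteq> f (x i) \<longleftrightarrow> i \<in> ?s ` E" if "i < 2 * n" for i
      proof -
        have "i \<in> ?s ` E \<longleftrightarrow> ?s i \<in> E"
          by (metis image_iff swap_halves_involution)
        moreover have "T \<sigma> x (?s i) = x i"
          using swap_halves_less[OF that] by (simp add: T_def swap_halves_involution)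
        ultimately show ?thesis using h(2)[of "?s i"] swap_halves_less[OF that, of \<sigma>] by simp
      qed
      moreover have "?s ` E \<subseteq> {..<2 * n}" using E(4) swap_halves_less by auto
      moreover have "x i \<in> D" if i: "i \<in> ?s ` E" for i
      proof -
        obtain j where j: "j \<in> E" "i = ?s j" using i by auto
        then show ?thesis using E(2)[of j] E(4) by (auto simp: T_def)
      qed
      moreover have "k \<le> card (?s ` E)"
        using E(3,4) bij by (subst card_image) (auto intro: inj_on_subset)
      ultimately have "?s ` E \<in> ?\<E>k" using h(1) by (auto simp: error_traces_def)
      moreover have "?s i \<notin> ?s ` E" if "i < n" for i
        using E(1) that swap_halves_involution by (metis disjoint_iff image_iff lessThan_iff)
      ultimately show "\<sigma> \<in> (\<Union>E\<in>?\<E>k. ?V E)" using \<sigma>(1) by blast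
    qed
    have finV: "finite (\<Union>E\<in>?\<E>k. ?V E)"
      by (rule finite_subset[of _ "Pow {..<n}"]) auto
    have V: "real (card (?V E)) \<le> 2 ^ n / 2 ^ k" if "E \<in> ?\<E>k" for E
    proof -
      have "real (card (?V E)) * 2 ^ k \<le> real (card (?V E)) * 2 ^ card E"
        using that by (intro mult_left_mono power_increasing) auto
      also have "\<dots> = real (card (?V E) * 2 ^ card E)" by simp
      also have "\<dots> \<le> real (2 ^ n)"
        by (intro of_nat_mono card_swap_halves_avoiding) (use that in \<open>auto simp: error_traces_def\<close>)
      finally show ?thesis by (simp add: field_simps)
    qed
    have "(\<Sum>\<sigma>\<in>Pow {..<n}. indicator ?B (T \<sigma> x)) = real (card {\<sigma>\<in>Pow {..<n}. T \<sigma> x \<in> ?B})"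
      by (simp add: indicator_def sum.If_cases Int_def)
    also have "\<dots> \<le> real (card (\<Union>E\<in>?\<E>k. ?V E))"
      by (intro of_nat_mono card_mono sub finV)
    also have "\<dots> \<le> real (\<Sum>E\<in>?\<E>k. card (?V E))"
      by (intro of_nat_mono card_UN_le fink)
    also have "\<dots> \<le> (\<Sum>E\<in>?\<E>k. 2 ^ n / 2 ^ k)"
      unfolding of_nat_sum by (intro sum_mono V)
    also have "\<dots> = 2 ^ n / 2 ^ k * real (card ?\<E>k)" by simp
    also have "\<dots> \<le> 2 ^ n / 2 ^ k * real (card ?\<E>)"
      using fin by (intro mult_left_mono of_nat_mono card_mono) auto
    also have "\<dots> \<le> 2 ^ n / 2 ^ k * ?N x"
      by (intro mult_left_mono of_nat_mono card_error_traces_le x) auto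
    finally show ?thesis .
  qed
  \<comment> \<open>Averaging over all exchanges is legitimate because each preserves the
    distribution.\<close>
  have "2 ^ n * measure ?Q ?B = (\<Sum>\<sigma>\<in>Pow {..<n}. measure (distr ?Q ?Q (T \<sigma>)) ?B)"
    unfolding T by (simp add: card_Pow)
  also have "\<dots> = (\<Sum>\<sigma>\<in>Pow {..<n}. \<integral>x. indicator ?B (T \<sigma> x) \<partial>?Q)"
  proof (intro sum.cong refl)
    fix \<sigma>
    have "measure (distr ?Q ?Q (T \<sigma>)) ?B = (\<integral>x. indicator ?B x \<partial>distr ?Q ?Q (T \<sigma>))"
      by simp
    also have "\<dots> = (\<integral>x. indicator ?B (T \<sigma> x) \<partial>?Q)"
      by (intro integral_distr) measurable
    finally show "measure (distr ?Q ?Q (T \<sigma>)) ?B = (\<integral>x. indicator ?B (T \<sigma> x) \<partial>?Q)" .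
  qed
  also have "\<dots> = (\<integral>x. (\<Sum>\<sigma>\<in>Pow {..<n}. indicator ?B (T \<sigma> x)) \<partial>?Q)"
    by (intro Bochner_Integration.integral_sum[symmetric] Q.integrable_const_bound[where B=1]) auto
  also have "\<dots> \<le> (\<integral>x. 2 ^ n / 2 ^ k * ?N x \<partial>?Q)"
  proof (rule integral_mono)
    show "integrable ?Q (\<lambda>x. \<Sum>\<sigma>\<in>Pow {..<n}. indicator ?B (T \<sigma> x) :: real)"
      by (intro Bochner_Integration.integrable_sum Q.integrable_const_bound[where B=1]) auto
    show "integrable ?Q (\<lambda>x. 2 ^ n / 2 ^ k * ?N x)"
      using integral_card_small_subsets(1)[OF D, of "2 * n" d] by (intro integrable_mult_right)
  qed (use pointwise in auto)
  also have "\<dots> = 2 ^ n / 2 ^ k * (\<Sum>i\<le>d. real (2 * n choose i) * prob D ^ i)"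
    using integral_card_small_subsets(2)[OF D, of "2 * n" d] by simp
  finally show ?thesis by (simp add: field_simps)
qed

text \<open>Only the sample points in \<open>D\<close> contribute to the number of error traces, so the logarithmic
  factor is that of \<open>n * prob D\<close> instead of \<open>n\<close>. The event that some consistent classifier has a
  large error need not be measurable; \<open>A\<close> is a measurable superset.\<close>

lemma consistent_error_small:
  assumes D: "D \<in> events" and d: "0 < d"
    and \<epsilon>: "4 \<le> real n * \<epsilon>" and X: "2 * real n * prob D \<le> X" "real d \<le> X"
  shows "\<exists>A\<in>sets (power_space n).
    measure (power_space n) A \<le> 2 * (exp 1 * X / d) ^ d * 2 powr - (real n * \<epsilon> / 4) \<and>
    (\<forall>x\<in>space (power_space n) - A. \<forall>h\<in>F. (\<forall>i<n. h (x i) = f (x i)) \<longrightarrow> errors h \<subseteq> D \<longrightarrow>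
      prob (errors h) \<le> \<epsilon>)"
proof -
  define I where "I = {..<n}"
  define J where "J = {n..<2 * n}"
  \<comment> \<open>A classifier of error above \<open>\<epsilon>\<close> has more than
    \<open>n * \<epsilon>\<close> expected errors on the second half; a quarter of that is reached
    with probability at least 1/2.\<close>
  define k where "k = nat \<lceil>real n * \<epsilon> / 4\<rceil>"
  let ?B = "ghost_event n D k"
  let ?QI = "\<Pi>\<^sub>M i\<in>I. M" and ?QJ = "\<Pi>\<^sub>M i\<in>J. M"
  let ?S = "\<lambda>x. (\<lambda>y. merge I J (x, y)) -` ?B \<inter> space ?QJ"
  \<comment> \<open>First halves whose conditional ghost probability is at least 1/2: measurable by
    Fubini, and of probability at most twice that of the ghost event.\<close>
  define A where "A = {x\<in>space ?QI. ennreal (1 / 2) \<le> emeasure ?QJ (?S x)}"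
  interpret Q: product_prob_space "\<lambda>_. M" "{..<2 * n}" by (rule product_prob_space_const)
  interpret QI: product_prob_space "\<lambda>_. M" I by (rule product_prob_space_const)
  interpret QJ: product_prob_space "\<lambda>_. M" J by (rule product_prob_space_const)
  have IJ: "I \<inter> J = {}" "finite I" "finite J" "I \<union> J = {..<2 * n}"
    by (auto simp: I_def J_def)
  have B: "?B \<in> sets (\<Pi>\<^sub>M i\<in>I \<union> J. M)"
    unfolding IJ(4) by (rule ghost_event_measurable[OF D])
  have [measurable]: "(\<lambda>x. emeasure ?QJ (?S x)) \<in> borel_measurable ?QI"
    using Q.emeasure_fold_measurable[OF IJ(1-3) B] .
  have A: "A \<in> sets ?QI" unfolding A_def by measurable
  have "ennreal (1 / 2) * emeasure ?QI A = (\<integral>\<^sup>+x. ennreal (1 / 2) * indicator A x \<partial>?QI)"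
    using A by (simp add: nn_integral_cmult_indicator)
  also have "\<dots> \<le> (\<integral>\<^sup>+x. emeasure ?QJ (?S x) \<partial>?QI)"
    by (intro nn_integral_mono) (auto simp: A_def indicator_def)
  also have "\<dots> = emeasure (power_space (2 * n)) ?B"
    using Q.emeasure_fold_integral[OF IJ(1-3) B] IJ(4) by simp
  finally have "ennreal (1 / 2) * emeasure ?QI A \<le> emeasure (power_space (2 * n)) ?B" .
  moreover have "ennreal (1 / 2 * measure ?QI A) = ennreal (1 / 2) * emeasure ?QI A"
    unfolding QI.emeasure_eq_measure by (intro ennreal_mult'') simp
  ultimately have "ennreal (1 / 2 * measure ?QI A) \<le> ennreal (measure (power_space (2 * n)) ?B)"
    by (simp only: Q.emeasure_eq_measure)
  then have "1 / 2 * measure ?QI A \<le> measure (power_space (2 * n)) ?B"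
    by (simp only: ennreal_le_iff measure_nonneg)
  then have "measure ?QI A \<le> 2 * measure (power_space (2 * n)) ?B" by simp
  also have "\<dots> \<le> 2 * ((exp 1 * X / d) ^ d / 2 ^ k)"
  proof -
    have "(\<Sum>i\<le>d. real (2 * n choose i) * prob D ^ i) \<le> (exp 1 * X / d) ^ d"
      using d X by (intro sum_binomial_power_le) auto
    then have "(\<Sum>i\<le>d. real (2 * n choose i) * prob D ^ i) / 2 ^ k \<le> (exp 1 * X / d) ^ d / 2 ^ k"
      by (intro divide_right_mono) auto
    then show ?thesis using ghost_event_prob_le[OF D, of n k] by linarith
  qed
  also have "\<dots> = 2 * (exp 1 * X / d) ^ d * 2 powr - real k"
    by (simp add: powr_minus powr_realpow field_simps)
  also have "\<dots> \<le> 2 * (exp 1 * X / d) ^ d * 2 powr - (real n * \<epsilon> / 4)"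
    using X d real_nat_ceiling_ge[of "real n * \<epsilon> / 4"]
    by (intro mult_left_mono powr_mono) (auto simp: k_def)
  finally have mA: "measure ?QI A \<le> 2 * (exp 1 * X / d) ^ d * 2 powr - (real n * \<epsilon> / 4)" .
  have "prob (errors h) \<le> \<epsilon>"
    if x: "x \<in> space ?QI - A" and h: "h \<in> F" and cons: "\<And>i. i < n \<Longrightarrow> h (x i) = f (x i)"
      and DD: "errors h \<subseteq> D" for x h
  proof (rule ccontr)
    assume "\<not> prob (errors h) \<le> \<epsilon>"
    then have less: "\<epsilon> < prob (errors h)" by simp
    let ?U = "errors h"
    note U = errors_measurable[OF h]
    let ?W = "{y\<in>space ?QJ. real (card {i\<in>J. y i \<in> ?U}) < real n * \<epsilon> / 4}"
    note hits_measurable[OF IJ(3) U, measurable]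
    have W: "?W \<in> sets ?QJ" by measurable
    have "space ?QJ - ?W \<subseteq> ?S x"
    proof
      fix y assume "y \<in> space ?QJ - ?W"
      then have y: "y \<in> space ?QJ" and "\<not> real (card {i\<in>J. y i \<in> ?U}) < real n * \<epsilon> / 4"
        by auto
      then have k: "k \<le> card {i\<in>J. y i \<in> ?U}" unfolding k_def by linarith
      let ?z = "merge I J (x, y)" and ?E = "{i\<in>J. y i \<in> ?U}"
      have z: "?z \<in> space (power_space (2 * n))"
        using x y IJ unfolding IJ(4)[symmetric] by (auto simp: space_PiM)
      have "h (?z i) \<noteq> f (?z i) \<longleftrightarrow> i \<in> ?E" if "i < 2 * n" for i
      proof (cases "i \<in> I")
        case True
        then show ?thesis using IJ(1) cons by (auto simp: merge_def I_def)
      next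
        case False
        then have "i \<in> J" using that by (auto simp: I_def J_def)
        then show ?thesis using False y by (auto simp: merge_def space_PiM)
      qed
      moreover have "?E \<subseteq> {..<2 * n}" by (auto simp: J_def)
      ultimately have "?E \<in> error_traces (2 * n) ?z" using h by (auto simp: error_traces_def)
      moreover have "?E \<inter> {..<n} = {}" by (auto simp: J_def)
      moreover have "?z i \<in> D" if "i \<in> ?E" for i
        using that DD IJ(1) by (auto simp: merge_def)
      ultimately have "?z \<in> ?B" using z k unfolding ghost_event_def by blast
      then show "y \<in> ?S x" using y by simp
    qed
    moreover have "(\<lambda>y. merge I J (x, y)) \<in> measurable ?QJ (\<Pi>\<^sub>M i\<in>I \<union> J. M)"
      using x by (intro measurable_compose[OF measurable_Pair1' measurable_merge]) auto
    then have "?S x \<in> sets ?QJ" by (rule measurable_sets[OF _ B])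
    ultimately have "emeasure ?QJ (space ?QJ - ?W) \<le> emeasure ?QJ (?S x)"
      by (rule emeasure_mono)
    moreover have "ennreal (1 / 2) \<le> emeasure ?QJ (space ?QJ - ?W)"
    proof -
      have "measure ?QJ ?W \<le> 2 powr (real n * \<epsilon> / 4) * exp (- (\<Sum>i\<in>J. prob ?U) / 2)"
        by (rule hits_less_prob_le[OF IJ(3) U])
      also have "(\<Sum>i\<in>J. prob ?U) = real n * prob ?U" by (simp add: J_def)
      also have "2 powr (real n * \<epsilon> / 4) * exp (- (real n * prob ?U) / 2)
          = exp (real n * \<epsilon> / 4 * ln 2 - real n * prob ?U / 2)"
        by (simp add: powr_def flip: exp_add)
      \<comment> \<open>Since \<open>ln 2 \<le> 1\<close> and \<open>4 \<le> n * \<epsilon>\<close>,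
        the exponent is at most
        \<open>n * \<epsilon> / 4 - n * \<epsilon> / 2 \<le> - 1\<close>.\<close>
      also have "\<dots> \<le> exp (- 1)"
      proof -
        have "real n * \<epsilon> / 4 * ln 2 \<le> real n * \<epsilon> / 4 * 1"
          using \<epsilon> ln2_le_25_over_36 by (intro mult_left_mono) auto
        moreover have "real n * \<epsilon> \<le> real n * prob ?U"
          using less by (intro mult_left_mono) auto
        ultimately show ?thesis using \<epsilon> by simp
      qed
      also have "\<dots> \<le> 1 / 2"
        using exp_ge_add_one_self[of 1] by (simp add: exp_minus field_simps)
      finally have "1 / 2 \<le> measure ?QJ (space ?QJ - ?W)"
        using QJ.prob_compl[OF W] by simp
      then show ?thesis
        unfolding QJ.emeasure_eq_measure by (rule ennreal_leI)
    qed
    ultimately have "x \<in> A" using x unfolding A_def by auto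
    then show False using x by simp
  qed
  then show ?thesis using A mA unfolding I_def by blast
qed

section \<open>Halving the radius of the version space\<close>

text \<open>After taking logarithms, \<open>d ln (t / d) \<le> t - d\<close> makes the union bound
  linear in \<open>t\<close>; the remaining terms
  \<open>d + d ln \<theta> + ln L - ln \<delta>\<close> are \<open>t\<close> itself. What has to
  hold is \<open>10 t ln 2 + 2 t \<le> 16 t ln 2\<close>, and \<open>ln 2 \<ge> 2 / 3\<close>
  suffices.\<close>

lemma symmetrization_constant:
  fixes \<theta> L \<delta> :: real
  assumes d: "0 < d" and \<theta>: "1 \<le> \<theta>" and L: "1 \<le> L" and \<delta>: "0 < \<delta>" "\<delta> < 1"
  defines "t \<equiv> real d * ln (exp 1 * \<theta>) + ln (L / \<delta>)"
  shows "real d \<le> t"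
    and "2 * (exp 1 * (256 * \<theta> * t) / d) ^ d * 2 powr - (16 * t) \<le> \<delta> / (2 * L)"
proof -
  have t: "t = real d + real d * ln \<theta> + ln L - ln \<delta>"
    using \<theta> L \<delta> by (simp add: t_def ln_mult ln_div algebra_simps)
  have nn: "0 \<le> real d * ln \<theta>" "0 \<le> ln L" "ln \<delta> < 0" using \<theta> L \<delta> by auto
  show td: "real d \<le> t" using nn t by linarith
  have t1: "1 \<le> t" using td d by simp
  let ?y = "t / d"
  have y: "0 < ?y" using d t1 by simp
  have "real d * ln ?y \<le> real d * (?y - 1)"
    by (intro mult_left_mono ln_le_minus_one y) auto
  also have "\<dots> = t - d" using d by (simp add: field_simps)
  finally have dy: "real d * ln ?y \<le> t - d" .
  have ln256: "ln (256::real) = 8 * ln 2"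
    using ln_realpow[of 2 8] by simp
  have ln2: "2 / 3 \<le> ln (2::real)" by (rule ln2_ge_two_thirds)
  have "ln (exp 1 * (256 * \<theta> * t) / d) = 1 + 8 * ln 2 + ln \<theta> + ln ?y"
    using y d \<theta> t1 by (simp add: ln_mult ln_div ln256)
  then have "(exp 1 * (256 * \<theta> * t) / d) ^ d = exp (real d * (1 + 8 * ln 2 + ln \<theta> + ln ?y))"
    using y d \<theta> t1 by (subst exp_of_nat_mult) (simp flip: \<open>ln (exp 1 * (256 * \<theta> * t) / d) = _\<close>)
  then have "2 * (exp 1 * (256 * \<theta> * t) / d) ^ d * 2 powr - (16 * t)
      = exp (ln 2 + real d * (1 + 8 * ln 2 + ln \<theta> + ln ?y) - 16 * t * ln 2)"
    by (simp add: powr_def exp_add exp_diff exp_minus field_simps)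
  also have "\<dots> \<le> exp (ln \<delta> - ln 2 - ln L)"
  proof (subst exp_le_cancel_iff)
    have "real d * (1 + 8 * ln 2 + ln \<theta> + ln ?y)
        = real d + real d * ln \<theta> + 8 * (ln 2 * real d) + real d * ln ?y"
      by (simp add: algebra_simps)
    moreover have "ln 2 * real d \<le> ln 2 * t" using td by (intro mult_left_mono) auto
    moreover have "ln 2 * 1 \<le> ln 2 * t" using t1 by (intro mult_left_mono) auto
    moreover have "2 / 3 * t \<le> ln 2 * t" using t1 ln2 by (intro mult_right_mono) auto
    moreover have "16 * t * ln 2 = 16 * (ln 2 * t)" by simp
    ultimately show "ln 2 + real d * (1 + 8 * ln 2 + ln \<theta> + ln ?y) - 16 * t * ln 2 \<le> ln \<delta> - ln 2 - ln L"
      using dy t t1 by linarith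
  qed
  also have "\<dots> = \<delta> / (2 * L)"
    using \<delta> L by (simp add: exp_diff exp_add field_simps)
  finally show "2 * (exp 1 * (256 * \<theta> * t) / d) ^ d * 2 powr - (16 * t) \<le> \<delta> / (2 * L)" .
qed

definition error_ball :: "real \<Rightarrow> ('a \<Rightarrow> int) set" where
  "error_ball r = {h\<in>F. prob (errors h) \<le> r}"

lemma f_in_error_ball: "0 \<le> r \<Longrightarrow> f \<in> error_ball r"
  using f_in_F by (simp add: error_ball_def)

lemma prob_restrict:
  assumes A: "A \<in> sets (power_space n)" and n: "n \<le> m"
  shows "{x\<in>space (power_space m). restrict x {..<n} \<in> A} \<in> sets (power_space m)"
    and "measure (power_space m) {x\<in>space (power_space m). restrict x {..<n} \<in> A} = measure (power_space n) A"
proof -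
  interpret Q: product_prob_space "\<lambda>_. M" "{..<m}" by (rule product_prob_space_const)
  have r: "(\<lambda>x. restrict x {..<n}) \<in> measurable (power_space m) (power_space n)"
    using n by (intro measurable_restrict_subset) auto
  have eq: "{x\<in>space (power_space m). restrict x {..<n} \<in> A}
      = (\<lambda>x. restrict x {..<n}) -` A \<inter> space (power_space m)" by auto
  show "{x\<in>space (power_space m). restrict x {..<n} \<in> A} \<in> sets (power_space m)"
    unfolding eq by (rule measurable_sets[OF r A])
  have "power_space n = distr (power_space m) (power_space n) (\<lambda>x. restrict x {..<n})"
    using n by (intro Q.distr_restrict) auto
  then have "measure (power_space n) A = measure (distr (power_space m) (power_space n) (\<lambda>x. restrict x {..<n})) A"
    by (rule arg_cong[of _ _ "\<lambda>N. measure N A"])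
  then show "measure (power_space m) {x\<in>space (power_space m). restrict x {..<n} \<in> A} = measure (power_space n) A"
    unfolding eq measure_distr[OF r A] ..
qed

text \<open>The version space of the first \<open>2 ^ k\<close> points lies in the ball of radius \<open>64 * t / 2 ^ k\<close>:
  the disagreement region of that ball has probability at most \<open>\<theta> * (64 * t / 2 ^ k)\<close>, so the
  error bound localized to it carries the logarithm of \<open>\<theta>\<close> only, and halves the radius.
  A point with index between \<open>2 ^ k\<close> and \<open>2 ^ (k + 1)\<close> is then queried only if it falls into this
  region, which adds an expected \<open>64 * \<theta> * t\<close> queries for each \<open>k\<close>.\<close>

lemma nhat_le_with_high_prob:
  fixes \<theta> L \<delta> :: real
  assumes d: "0 < d" and \<theta>: "1 \<le> \<theta>" and L: "1 \<le> L" and \<delta>: "0 < \<delta>" "\<delta> < 1"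
  defines "t \<equiv> real d * ln (exp 1 * \<theta>) + ln (L / \<delta>)"
  assumes D_meas: "\<And>r. 0 < r \<Longrightarrow> DIS M (error_ball r) \<in> events"
    and D_prob: "\<And>k. 2 ^ k < m \<Longrightarrow> prob (DIS M (error_ball (64 * t / 2 ^ k))) \<le> \<theta> * (64 * t / 2 ^ k)"
    and epochs: "\<And>k. 2 ^ k < m \<Longrightarrow> real k + 1 \<le> L"
  obtains G where "G \<in> sets (power_space m)" "1 - \<delta> \<le> measure (power_space m) G"
    and "\<And>x \<omega>. x \<in> G \<Longrightarrow> (\<And>i. i < m \<Longrightarrow> \<omega> i = (x i, f (x i))) \<Longrightarrow>
            real (nhat F (sample m \<omega>)) \<le> 100 * \<theta> * t * L"
proof -
  interpret Q: product_prob_space "\<lambda>_. M" "{..<m}" by (rule product_prob_space_const)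
  note const = symmetrization_constant[OF d \<theta> L \<delta>, folded t_def]
  have t1: "1 \<le> t" using const(1) d by simp
  define D where "D k = DIS M (error_ball (64 * t / 2 ^ k))" for k :: nat
  have Dm: "D k \<in> events" for k using t1 unfolding D_def by (intro D_meas) simp
  have Dp: "prob (D k) \<le> \<theta> * (64 * t / 2 ^ k)" if "2 ^ k < m" for k
    unfolding D_def by (rule D_prob[OF that])
  \<comment> \<open>Epoch \<open>k\<close> consists of the indices from \<open>2 ^ k\<close> up to
    \<open>2 ^ (k + 1) - 1\<close>; \<open>J\<close> collects the epochs that begin before
    \<open>m\<close>.\<close>
  define J where "J = {k. 2 ^ k < m}"
  have Jsub: "J \<subseteq> {..<nat \<lfloor>L\<rfloor>}"
  proof
    fix k assume "k \<in> J"
    then have "int k + 1 \<le> \<lfloor>L\<rfloor>" using epochs[of k] by (simp add: J_def le_floor_iff)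
    then show "k \<in> {..<nat \<lfloor>L\<rfloor>}" by simp
  qed
  then have finJ: "finite J" by (rule finite_subset) simp
  have "card J \<le> nat \<lfloor>L\<rfloor>" using card_mono[OF _ Jsub] by simp
  then have cJ: "real (card J) \<le> L" using L by linarith

  \<comment> \<open>The premise \<open>errors h \<subseteq> D j\<close> is what the previous radius
    provides; keeping it as a premise makes the exceptional set independent of the
    induction.\<close>
  define exceptional where "exceptional j A \<longleftrightarrow> A \<in> sets (power_space (2 ^ Suc j)) \<and>
      measure (power_space (2 ^ Suc j)) A \<le> \<delta> / (2 * L) \<and>
      (\<forall>x\<in>space (power_space (2 ^ Suc j)) - A. \<forall>h\<in>F.
        (\<forall>i<2 ^ Suc j. h (x i) = f (x i)) \<longrightarrow> errors h \<subseteq> D j \<longrightarrow> prob (errors h) \<le> 64 * t / 2 ^ Suc j)"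
    for j A
  define J' where "J' = {j. 2 ^ Suc j < m}"
  have J'J: "J' \<subseteq> J" by (auto simp: J_def J'_def)
  have "\<forall>j\<in>J'. \<exists>A. exceptional j A"
  proof
    fix j assume "j \<in> J'"
    then have j: "2 ^ Suc j < m" by (simp add: J'_def)
    have p1: "4 \<le> real (2 ^ Suc j) * (64 * t / 2 ^ Suc j)" using t1 by simp
    \<comment> \<open>The region belongs to the radius at \<open>2 ^ j\<close> points, the double
      sample has \<open>2 * 2 ^ (j + 1)\<close> points: the factor is
      \<open>4 * 64 = 256\<close>.\<close>
    have p2: "2 * real (2 ^ Suc j) * prob (D j) \<le> 256 * \<theta> * t"
    proof -
      have "2 ^ j < m" using j by simp
      then have "2 * real (2 ^ Suc j) * prob (D j) \<le> 2 * real (2 ^ Suc j) * (\<theta> * (64 * t / 2 ^ j))"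
        by (intro mult_left_mono Dp) auto
      then show ?thesis by simp
    qed
    have p3: "real d \<le> 256 * \<theta> * t"
    proof -
      have "1 * t \<le> (256 * \<theta>) * t" using \<theta> t1 by (intro mult_right_mono) auto
      then show ?thesis using const(1) by simp
    qed
    have "real (2 ^ Suc j) * (64 * t / 2 ^ Suc j) / 4 = 16 * t" by simp
    with const(2) have "2 * (exp 1 * (256 * \<theta> * t) / d) ^ d
        * 2 powr - (real (2 ^ Suc j) * (64 * t / 2 ^ Suc j) / 4) \<le> \<delta> / (2 * L)"
      by (simp only:)
    with consistent_error_small[OF Dm[of j] d p1 p2 p3] show "\<exists>A. exceptional j A"
      unfolding exceptional_def by (meson order_trans)
  qed
  then obtain A where "\<forall>j\<in>J'. exceptional j (A j)" by (rule bchoice[THEN exE])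
  then have A: "exceptional j (A j)" if "j \<in> J'" for j using that by blast
  define Bad where "Bad j = {x\<in>space (power_space m). restrict x {..<2 ^ Suc j} \<in> A j}" for j
  have Bad: "Bad j \<in> sets (power_space m)" "measure (power_space m) (Bad j) \<le> \<delta> / (2 * L)"
    if "j \<in> J'" for j
    using A[OF that] prob_restrict[of "A j" "2 ^ Suc j" m] that
    unfolding Bad_def J'_def exceptional_def by auto
  have "measure (power_space m) (\<Union>j\<in>J'. Bad j) \<le> (\<Sum>j\<in>J'. measure (power_space m) (Bad j))"
    using finJ J'J Bad by (intro Q.finite_measure_subadditive_finite) (auto intro: finite_subset)
  also have "\<dots> \<le> real (card J') * (\<delta> / (2 * L))"
    using Bad by (intro sum_bounded_above) auto
  also have "\<dots> \<le> L * (\<delta> / (2 * L))"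
    using cJ card_mono[OF finJ J'J] L \<delta> by (intro mult_right_mono) auto
  also have "\<dots> = \<delta> / 2" using L by simp
  finally have mBad: "measure (power_space m) (\<Union>j\<in>J'. Bad j) \<le> \<delta> / 2" .

  \<comment> \<open>Index \<open>i\<close> has \<open>i\<close> predecessors, at least
    \<open>2 ^ floor_log i\<close> of them, so the region of that epoch applies. Index 0 has no
    predecessor and is put into the compression set separately.\<close>
  define R where "R i = (if i = 0 then {} else D (floor_log i))" for i
  \<comment> \<open>Chosen such that \<open>2 powr - a * exp (64 * \<theta> * t * L)\<close> is
    exactly \<open>\<delta> / 2\<close>.\<close>
  define a where "a = (64 * \<theta> * t * L + ln (2 / \<delta>)) / ln 2"
  define Many where "Many = {x\<in>space (power_space m). a \<le> real (card {i\<in>{..<m}. x i \<in> R i})}"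
  have Rm: "R i \<in> events" for i using Dm by (auto simp: R_def)
  have Many: "Many \<in> sets (power_space m)"
  proof -
    note hits_measurable[of "{..<m}" R, OF _ Rm, measurable]
    show ?thesis unfolding Many_def by measurable
  qed
  have fl: "2 ^ floor_log i \<le> i" "i < 2 ^ Suc (floor_log i)" if "0 < i" for i
    using floor_log_exp2_le[OF that] floor_log_exp2_gt[of i] by (auto simp: mult.commute)
  have "(\<Sum>i<m. prob (R i)) \<le> 64 * \<theta> * t * L"
  proof -
    have "(\<Sum>i<m. prob (R i)) = (\<Sum>i\<in>{0<..<m}. prob (D (floor_log i)))"
      by (rule sum.mono_neutral_cong_right) (auto simp: R_def)
    also have "\<dots> = (\<Sum>k\<in>J. \<Sum>i | i \<in> {0<..<m} \<and> floor_log i = k. prob (D (floor_log i)))"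
      using finJ le_less_trans[OF fl(1)] by (intro sum.group[symmetric]) (auto simp: J_def)
    also have "\<dots> \<le> (\<Sum>k\<in>J. 64 * \<theta> * t)"
    proof (rule sum_mono)
      fix k assume k: "k \<in> J"
      \<comment> \<open>The at most \<open>2 ^ k\<close> indices of an epoch cancel the
        \<open>2 ^ k\<close> in its radius, so all epochs get the same bound.\<close>
      let ?I = "{i. i \<in> {0<..<m} \<and> floor_log i = k}"
      have "?I \<subseteq> {2 ^ k..<2 ^ Suc k}" using fl by auto
      then have "card ?I \<le> 2 ^ k" using card_mono[of "{2 ^ k..<2 ^ Suc k}" ?I] by simp
      then have cI: "real (card ?I) \<le> 2 ^ k" by (metis of_nat_le_iff of_nat_numeral of_nat_power)
      have "(\<Sum>i\<in>?I. prob (D (floor_log i))) \<le> real (card ?I) * (\<theta> * (64 * t / 2 ^ k))"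
        using Dp k by (intro sum_bounded_above) (auto simp: J_def)
      also have "\<dots> \<le> 2 ^ k * (\<theta> * (64 * t / 2 ^ k))"
        using cI \<theta> t1 by (intro mult_right_mono) auto
      finally show "(\<Sum>i\<in>?I. prob (D (floor_log i))) \<le> 64 * \<theta> * t" by simp
    qed
    also have "\<dots> = 64 * \<theta> * t * real (card J)" by simp
    also have "\<dots> \<le> 64 * \<theta> * t * L" using cJ \<theta> t1 by (intro mult_left_mono) auto
    finally show ?thesis .
  qed
  then have "2 powr - a * exp (\<Sum>i<m. prob (R i)) \<le> 2 powr - a * exp (64 * \<theta> * t * L)"
    by (intro mult_left_mono) auto
  also have "\<dots> = exp (- ln (2 / \<delta>))"
    by (simp add: powr_def a_def flip: exp_add)
  also have "\<dots> = \<delta> / 2" using \<delta> by (simp add: exp_minus)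
  finally have mMany: "measure (power_space m) Many \<le> \<delta> / 2"
    using hits_ge_prob_le[of "{..<m}" R a] Rm unfolding Many_def by fastforce

  define G where "G = space (power_space m) - ((\<Union>j\<in>J'. Bad j) \<union> Many)"
  have UBad: "(\<Union>j\<in>J'. Bad j) \<in> sets (power_space m)"
    using finJ J'J Bad by (intro sets.finite_UN) (auto intro: finite_subset)
  have G: "G \<in> sets (power_space m)" using UBad Many by (auto simp: G_def)
  have "measure (power_space m) ((\<Union>j\<in>J'. Bad j) \<union> Many) \<le> \<delta> / 2 + \<delta> / 2"
    using mBad mMany measure_Un_le[OF UBad Many] by linarith
  then have mG: "1 - \<delta> \<le> measure (power_space m) G"
    unfolding G_def using UBad Many by (subst Q.prob_compl) auto
  have "real (nhat F (sample m \<omega>)) \<le> 100 * \<theta> * t * L"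
    if x: "x \<in> G" and \<omega>: "\<And>i. i < m \<Longrightarrow> \<omega> i = (x i, f (x i))" for x \<omega>
  proof -
    have xs: "x \<in> space (power_space m)" using x by (simp add: G_def)
    have ball: "h \<in> error_ball (64 * t / 2 ^ k)"
      if "2 ^ k < m" "h \<in> F" "\<And>i. i < 2 ^ k \<Longrightarrow> h (x i) = f (x i)" for k h
      using that
    proof (induction k)
      \<comment> \<open>The first radius \<open>64 * t\<close> exceeds 1, so the induction starts
        without any probabilistic input.\<close>
      case 0
      have "prob (errors h) \<le> 64 * t" using prob_le_1[of "errors h"] t1 by linarith
      then show ?case using 0 by (simp add: error_ball_def)
    next
      case (Suc j)
      have j: "j \<in> J'" using Suc.prems(1) by (simp add: J'_def)
      have hj: "h \<in> error_ball (64 * t / 2 ^ j)" using Suc by auto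
      have "f \<in> error_ball (64 * t / 2 ^ j)" using t1 by (intro f_in_error_ball) simp
      then have "errors h \<subseteq> D j" using hj unfolding D_def DIS_def by blast
      moreover have "restrict x {..<2 ^ Suc j} \<in> space (power_space (2 ^ Suc j)) - A j"
      proof -
        have "x \<notin> Bad j" using x j by (auto simp: G_def)
        moreover have "restrict x {..<2 ^ Suc j} \<in> space (power_space (2 ^ Suc j))"
          using power_space_component[OF xs] Suc.prems(1) by (auto simp: space_PiM)
        ultimately show ?thesis using xs by (simp add: Bad_def)
      qed
      ultimately have "prob (errors h) \<le> 64 * t / 2 ^ Suc j"
        using Suc.prems A[OF j] unfolding exceptional_def by auto
      then show ?case using Suc.prems(2) by (simp add: error_ball_def)
    qed
    let ?H = "{i\<in>{..<m}. x i \<in> R i}"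
    have "nhat F (sample m \<omega>) \<le> card (insert 0 ?H \<inter> {..<m})"
    proof (rule nhat_le_card_queried[of m \<omega> x f, OF \<omega>])
      fix i h assume i: "i < m" "i \<notin> insert 0 ?H" and h: "h \<in> F" "\<And>j. j < i \<Longrightarrow> h (x j) = f (x j)"
      have i0: "0 < i" using i by auto
      have "h \<in> error_ball (64 * t / 2 ^ floor_log i)"
        using fl(1)[OF i0] i h by (intro ball) auto
      moreover have "f \<in> error_ball (64 * t / 2 ^ floor_log i)"
        using t1 by (intro f_in_error_ball) simp
      moreover have "x i \<notin> D (floor_log i)" using i i0 by (auto simp: R_def)
      ultimately show "h (x i) = f (x i)"
        using power_space_component[OF xs i(1)] unfolding D_def DIS_def by blast
    qed
    also have "\<dots> \<le> card (insert 0 ?H)" by (intro card_mono) auto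
    also have "\<dots> \<le> Suc (card ?H)" by (rule card_insert_le_m1) auto
    finally have "real (nhat F (sample m \<omega>)) \<le> 1 + real (card ?H)" by linarith
    moreover have "real (card ?H) < a" using x xs by (auto simp: G_def Many_def)
    \<comment> \<open>The sum \<open>64 + 2 = 66\<close> becomes 99 on division by
      \<open>ln 2 \<ge> 2 / 3\<close>; the last unit of 100 pays for index 0.\<close>
    moreover have "a \<le> 99 * \<theta> * t * L"
    proof -
      have tL: "1 * 1 * 1 \<le> \<theta> * t * L" "1 * t * 1 \<le> \<theta> * t * L"
        using \<theta> t1 L by (intro mult_mono mult_nonneg_nonneg; simp)+
      have "ln (2 / \<delta>) = ln 2 + ln (1 / \<delta>)" using \<delta> by (simp add: ln_div)
      moreover have "ln (2::real) \<le> 1" using ln2_le_25_over_36 by simp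
      moreover have "ln (1 / \<delta>) \<le> t"
      proof -
        have "ln (1 / \<delta>) \<le> ln (L / \<delta>)" using L \<delta> by (simp add: divide_right_mono)
        moreover have "0 \<le> real d * ln (exp 1 * \<theta>)" using \<theta> by (simp add: ln_mult)
        ultimately show ?thesis by (simp add: t_def)
      qed
      ultimately have "ln (2 / \<delta>) \<le> 2 * (\<theta> * t * L)" using tL by linarith
      then have "64 * \<theta> * t * L + ln (2 / \<delta>) \<le> 66 * (\<theta> * t * L)"
        by (simp add: algebra_simps)
      also have "\<dots> \<le> (99 * \<theta> * t * L) * (2 / 3)" by simp
      also have "\<dots> \<le> (99 * \<theta> * t * L) * ln 2"
        using \<theta> t1 L ln2_ge_two_thirds by (intro mult_left_mono) auto
      finally show ?thesis unfolding a_def by (simp add: pos_divide_le_eq)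
    qed
    moreover have "1 * 1 * 1 \<le> \<theta> * t * L"
      using \<theta> t1 L by (intro mult_mono mult_nonneg_nonneg) auto
    ultimately show ?thesis by simp
  qed
  then show ?thesis using that[OF G mG] by blast
qed

end

section \<open>From the joint distribution to the instance marginal\<close>

text \<open>A subsample has a larger version space iff some classifier fits it but misses a label
  elsewhere. For each of the finitely many labellings \<open>z\<close> by that classifier, this is a
  trace event together with conditions on the observed labels, which need not come from
  \<open>f\<close>.\<close>

lemma nhat_event_measurable:
  assumes sets_P: "sets P = sets (M \<Otimes>\<^sub>M count_space labels)"
    and F: "F \<subseteq> classifiers M" and tr: "trace_measurable M F"
  defines "\<Omega> \<equiv> \<Pi>\<^sub>M i\<in>(UNIV :: nat set). P"
  shows "{\<omega>\<in>space \<Omega>. nhat F (sample m \<omega>) \<le> b} \<in> sets \<Omega>"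
proof -
  have space_P: "space P = space M \<times> labels"
    using sets_eq_imp_space_eq[OF sets_P] by (simp add: space_pair_measure)
  note measurable_cong_sets[OF sets_P refl, simp]
  have fst_P: "fst \<in> measurable P M" and snd_P: "snd \<in> measurable P (count_space labels)" by simp_all
  let ?N = "\<Pi>\<^sub>M i\<in>{..<m}. M"
  have \<Phi>: "(\<lambda>\<omega>. \<lambda>i\<in>{..<m}. fst (\<omega> i)) \<in> measurable \<Omega> ?N"
    unfolding \<Omega>_def
    by (intro measurable_restrict measurable_compose[OF measurable_component_singleton[of _ _ "\<lambda>_. P"] fst_P]) auto
  have comp: "\<omega> i \<in> space M \<times> labels" if "\<omega> \<in> space \<Omega>" for \<omega> i
    using that by (auto simp: \<Omega>_def space_PiM space_P[symmetric])
  have lab: "{\<omega>\<in>space \<Omega>. snd (\<omega> i) = z} \<in> sets \<Omega>" if "z \<in> labels" for i z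
  proof -
    have "(\<lambda>\<omega>. snd (\<omega> i)) \<in> measurable \<Omega> (count_space labels)"
      unfolding \<Omega>_def by (intro measurable_compose[OF measurable_component_singleton[of _ _ "\<lambda>_. P"] snd_P]) auto
    then have "(\<lambda>\<omega>. snd (\<omega> i)) -` {z} \<inter> space \<Omega> \<in> sets \<Omega>"
      by (rule measurable_sets) (use that in auto)
    then show ?thesis by (simp add: vimage_def Int_def conj_commute)
  qed
  have VS_event: "{\<omega>\<in>space \<Omega>. VS F (\<omega> ` I) = VS F (\<omega> ` {..<m})} \<in> sets \<Omega>" if I: "I \<subseteq> {..<m}" for I
  proof -
    let ?Z = "\<Pi>\<^sub>E i\<in>{..<m}. labels"
    let ?A = "\<lambda>z. {\<omega>\<in>space \<Omega>. \<exists>h\<in>F. \<forall>i<m. h (fst (\<omega> i)) = z i}"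
    let ?B = "\<lambda>z. {\<omega>\<in>space \<Omega>. \<forall>i\<in>I. snd (\<omega> i) = z i}"
    let ?C = "\<lambda>z. {\<omega>\<in>space \<Omega>. \<exists>i\<in>{..<m}. \<not> snd (\<omega> i) = z i}"
    define U where "U = (\<Union>z\<in>?Z. ?A z \<inter> ?B z \<inter> ?C z)"
    have "{\<omega>\<in>space \<Omega>. VS F (\<omega> ` I) = VS F (\<omega> ` {..<m})} = space \<Omega> - U"
    proof -
      have "VS F (\<omega> ` I) \<noteq> VS F (\<omega> ` {..<m}) \<longleftrightarrow> \<omega> \<in> U"
        if \<omega>: "\<omega> \<in> space \<Omega>" for \<omega>
      proof
        assume "VS F (\<omega> ` I) \<noteq> VS F (\<omega> ` {..<m})"
        then obtain h where "h \<in> VS F (\<omega> ` I)" "h \<notin> VS F (\<omega> ` {..<m})"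
          using VS_antimono[of "\<omega> ` I" "\<omega> ` {..<m}" F] I by blast
        then have h: "h \<in> F" "\<forall>i\<in>I. snd (\<omega> i) = h (fst (\<omega> i))" "\<exists>i\<in>{..<m}. \<not> snd (\<omega> i) = h (fst (\<omega> i))"
          by (force simp: VS_def split_beta)+
        define z where "z = (\<lambda>i\<in>{..<m}. h (fst (\<omega> i)))"
        have "h (fst (\<omega> i)) \<in> labels" for i
          by (rule classifier_in_labels[of h M]) (use h(1) F comp[OF \<omega>, of i] in auto)
        then have "z \<in> ?Z" by (auto simp: z_def)
        moreover have "\<omega> \<in> ?A z" using \<omega> h(1) by (auto simp: z_def)
        moreover have "\<omega> \<in> ?B z" using \<omega> h(2) I by (auto simp: z_def)
        moreover have "\<omega> \<in> ?C z" using \<omega> h(3) by (auto simp: z_def)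
        ultimately show "\<omega> \<in> U" unfolding U_def by blast
      next
        assume "\<omega> \<in> U"
        then obtain z h where z: "h \<in> F" "\<forall>i<m. h (fst (\<omega> i)) = z i" "\<forall>i\<in>I. snd (\<omega> i) = z i"
          "\<exists>i\<in>{..<m}. \<not> snd (\<omega> i) = z i" unfolding U_def by blast
        have "h \<in> VS F (\<omega> ` I)" using z(1-3) I by (auto simp: VS_def split_beta)
        moreover have "h \<notin> VS F (\<omega> ` {..<m})" using z(2,4) by (force simp: VS_def split_beta)
        ultimately show "VS F (\<omega> ` I) \<noteq> VS F (\<omega> ` {..<m})" by blast
      qed
      then show ?thesis by blast
    qed
    also have "\<dots> \<in> sets \<Omega>"
      unfolding U_def
    proof (intro sets.Diff sets.top sets.finite_UN sets.Int finite_PiE)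
      fix z assume z: "z \<in> ?Z"
      then have "z \<in> {..<m} \<rightarrow> labels" by (auto simp: PiE_def)
      then have "{x\<in>space ?N. \<exists>h\<in>F. \<forall>i<m. h (x i) = z i} \<in> sets ?N"
        by (rule tr[unfolded trace_measurable_def, rule_format])
      from measurable_sets[OF \<Phi> this] have "(\<lambda>\<omega>. \<lambda>i\<in>{..<m}. fst (\<omega> i)) -` {x\<in>space ?N. \<exists>h\<in>F. \<forall>i<m. h (x i) = z i} \<inter> space \<Omega> \<in> sets \<Omega>" .
      also have "(\<lambda>\<omega>. \<lambda>i\<in>{..<m}. fst (\<omega> i)) -` {x\<in>space ?N. \<exists>h\<in>F. \<forall>i<m. h (x i) = z i} \<inter> space \<Omega> = ?A z"
        using measurable_space[OF \<Phi>] by auto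
      finally show "?A z \<in> sets \<Omega>" .
      have zl: "z i \<in> labels" if "i < m" for i using PiE_mem[OF z] that by simp
      show "?B z \<in> sets \<Omega>"
        by (intro sets.sets_Collect_finite_All lab zl) (use I finite_subset[OF I] in auto)
      show "?C z \<in> sets \<Omega>"
        by (intro sets.sets_Collect_finite_Ex sets.sets_Collect_neg lab zl) auto
    qed auto
    finally show ?thesis .
  qed
  have "{\<omega>\<in>space \<Omega>. nhat F (sample m \<omega>) \<le> b}
      = (\<Union>I\<in>{I\<in>Pow {..<m}. card I \<le> b}. {\<omega>\<in>space \<Omega>. VS F (\<omega> ` I) = VS F (\<omega> ` {..<m})})"
    by (auto simp: nhat_le_iff)
  also have "\<dots> \<in> sets \<Omega>" by (intro sets.finite_UN VS_event) auto
  finally show ?thesis .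
qed

text \<open>Integrating the conditional probability, which is 1 everywhere, over the whole instance
  space gives the event probability 1.\<close>

lemma realizable_by_AE:
  assumes P: "prob_space P" "sets P = sets (M \<Otimes>\<^sub>M count_space labels)" and r: "realizable_by M P f"
  shows "AE z in P. snd z = f (fst z)"
proof -
  interpret prob_space P by fact
  have space_P: "space P = space M \<times> labels"
    using sets_eq_imp_space_eq[OF P(2)] by (simp add: space_pair_measure)
  have fst_P: "fst \<in> measurable P M" by (simp add: measurable_cong_sets[OF P(2) refl])
  interpret \<mu>: prob_space "distr P M fst" by (rule prob_space_distr[OF fst_P])
  obtain q where q: "cond_prob_version M P {(x, y)\<in>space P. y = f x} q" "\<And>x. x \<in> space M \<Longrightarrow> q x = 1"
    using r unfolding realizable_by_def by blast
  have "prob ({(x, y)\<in>space P. y = f x} \<inter> (space M \<times> labels)) = (LINT x:space M|distr P M fst. q x)"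
    using q(1) unfolding cond_prob_version_def by blast
  also have "\<dots> = (\<integral>x. 1 \<partial>distr P M fst)"
    unfolding set_lebesgue_integral_def by (intro Bochner_Integration.integral_cong) (auto simp: q(2))
  also have "\<dots> = 1" using \<mu>.prob_space by simp
  also have "{(x, y)\<in>space P. y = f x} \<inter> (space M \<times> labels) = {(x, y)\<in>space P. y = f x}"
    by (auto simp: space_P)
  finally have "AE z in P. z \<in> {(x, y)\<in>space P. y = f x}" by (rule AE_prob_1)
  then show ?thesis by eventually_elim auto
qed

text \<open>The first \<open>m\<close> instances of the i.i.d. sequence have the product of the
  marginals as distribution, and their labels are almost surely those of \<open>f\<close>; a good
  set of instance tuples thus bounds \<open>nhat\<close> with the same probability.\<close>

lemma B_nhat_le:
  assumes P: "prob_space P" and sets_P: "sets P = sets (M \<Otimes>\<^sub>M count_space labels)"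
    and F: "F \<subseteq> classifiers M" and tr: "trace_measurable M F" and r: "realizable_by M P f"
    and G: "G \<in> sets (\<Pi>\<^sub>M i\<in>{..<m}. distr P M fst)" "1 - \<delta> \<le> measure (\<Pi>\<^sub>M i\<in>{..<m}. distr P M fst) G"
    and b: "\<And>x \<omega>. x \<in> G \<Longrightarrow> (\<And>i. i < m \<Longrightarrow> \<omega> i = (x i, f (x i))) \<Longrightarrow> nhat F (sample m \<omega>) \<le> b"
  shows "B_nhat P F m \<delta> \<le> b"
proof -
  let ?\<Omega> = "\<Pi>\<^sub>M i\<in>(UNIV :: nat set). P" and ?Q = "\<Pi>\<^sub>M i\<in>{..<m}. distr P M fst"
  interpret P: prob_space P by fact
  interpret \<Omega>: product_prob_space "\<lambda>_. P" "UNIV :: nat set" by (rule P.product_prob_space_const)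
  have fst_P: "fst \<in> measurable P M" by (simp add: measurable_cong_sets[OF sets_P refl])
  let ?\<mu> = "distr P M fst"
  have \<mu>: "prob_space ?\<mu>" by (rule P.prob_space_distr[OF fst_P])
  let ?N = "{\<omega>\<in>space ?\<Omega>. nhat F (sample m \<omega>) \<le> b}"
  define \<Phi> where "\<Phi> = (\<lambda>\<omega> :: nat \<Rightarrow> 'a \<times> int. compose {..<m} fst (restrict \<omega> {..<m}))"
  have res: "(\<lambda>\<omega>. restrict \<omega> {..<m}) \<in> measurable ?\<Omega> (\<Pi>\<^sub>M i\<in>{..<m}. P)"
    by (intro measurable_restrict_subset) auto
  have cmp: "compose {..<m} fst \<in> measurable (\<Pi>\<^sub>M i\<in>{..<m}. P) ?Q"
    unfolding compose_def
    by (intro measurable_restrict measurable_compose[OF measurable_component_singleton]) (auto simp: fst_P)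
  have "distr ?\<Omega> ?Q \<Phi> = distr (distr ?\<Omega> (\<Pi>\<^sub>M i\<in>{..<m}. P) (\<lambda>\<omega>. restrict \<omega> {..<m})) ?Q (compose {..<m} fst)"
    using distr_distr[OF cmp res] by (simp add: \<Phi>_def comp_def)
  also have "\<dots> = distr (\<Pi>\<^sub>M i\<in>{..<m}. P) ?Q (compose {..<m} fst)"
    by (subst \<Omega>.distr_PiM_restrict_finite) auto
  also have "\<dots> = (\<Pi>\<^sub>M i\<in>{..<m}. distr P ?\<mu> fst)"
    by (rule distr_PiM_finite_prob_space') (auto simp: P \<mu> fst_P)
  also have "distr P ?\<mu> fst = ?\<mu>" by (rule distr_cong) auto
  finally have distr_\<Phi>: "distr ?\<Omega> ?Q \<Phi> = ?Q" .
  have \<Phi>: "\<Phi> \<in> measurable ?\<Omega> ?Q"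
    unfolding \<Phi>_def by (rule measurable_compose[OF res cmp])
  have AE: "AE \<omega> in ?\<Omega>. \<forall>i\<in>{..<m}. snd (\<omega> i) = f (fst (\<omega> i))"
    by (intro AE_finite_allI AE_PiM_component[where P="\<lambda>z. snd z = f (fst z)"] realizable_by_AE[OF P sets_P r]) (auto simp: P)
  have "measure ?Q G = measure (distr ?\<Omega> ?Q \<Phi>) G" unfolding distr_\<Phi> ..
  also have "\<dots> = measure ?\<Omega> (\<Phi> -` G \<inter> space ?\<Omega>)" by (rule measure_distr[OF \<Phi> G(1)])
  also have "\<dots> \<le> measure ?\<Omega> ?N"
  proof (rule \<Omega>.finite_measure_mono_AE)
    show "AE \<omega> in ?\<Omega>. \<omega> \<in> \<Phi> -` G \<inter> space ?\<Omega> \<longrightarrow> \<omega> \<in> ?N"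
      using AE
    proof eventually_elim
      case (elim \<omega>)
      have "nhat F (sample m \<omega>) \<le> b" if "\<Phi> \<omega> \<in> G"
        using elim by (intro b[OF that]) (auto simp: \<Phi>_def compose_def prod_eq_iff)
      then show ?case by auto
    qed
    show "?N \<in> sets ?\<Omega>" by (rule nhat_event_measurable[OF sets_P F tr])
  qed
  finally have "1 - \<delta> \<le> measure ?\<Omega> ?N" using G(2) by linarith
  then show ?thesis unfolding B_nhat_def by (rule Least_le)
qed

lemma Delta_eq:
  assumes "sets P = sets (M \<Otimes>\<^sub>M count_space labels)" "DIS M H \<in> sets M"
  shows "Delta M P H = measure (distr P M fst) (DIS M H)"
proof -
  have space_P: "space P = space M \<times> labels"
    using sets_eq_imp_space_eq[OF assms(1)] by (simp add: space_pair_measure)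
  have fst_P: "fst \<in> measurable P M" by (simp add: measurable_cong_sets[OF assms(1) refl])
  have "fst -` DIS M H \<inter> space P = DIS M H \<times> labels"
    using sets.sets_into_space[OF assms(2)] by (auto simp: space_P)
  then show ?thesis unfolding Delta_def using measure_distr[OF fst_P assms(2)] by simp
qed

lemma B_nhat_bound:
  fixes M :: "'a measure"
  assumes P: "prob_space P" and sets_P: "sets P = sets (M \<Otimes>\<^sub>M count_space labels)"
    and F: "F \<subseteq> classifiers M" and vc: "has_VC_dim M F d" and fF: "f \<in> F"
    and rl: "realizable_by M P f" and tr: "trace_measurable M F"
    and DIS_meas: "\<And>r. 0 < r \<Longrightarrow> DIS M (classifier_ball M P F f r) \<in> sets M"
    and r0: "0 < r0" "r0 < 1" and \<delta>: "0 < \<delta>" "\<delta> < 1" and r: "r0 < r" "r < 1"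
  defines "\<theta> \<equiv> disagreement_coeff M P F f (real d * r0)" and "L \<equiv> log 2 (2 / r0)"
  shows "real (B_nhat P F (nat \<lceil>1 / r\<rceil>) \<delta>)
    \<le> 100 * \<theta> * (real d * ln (exp 1 * \<theta>) + ln (L / \<delta>)) * L"
proof -
  let ?\<mu> = "distr P M fst"
  define m where "m = nat \<lceil>1 / r\<rceil>"
  define t where "t = real d * ln (exp 1 * \<theta>) + ln (L / \<delta>)"
  interpret P: prob_space P by fact
  have fst_P: "fst \<in> measurable P M" by (simp add: measurable_cong_sets[OF sets_P refl])
  interpret \<mu>: prob_space ?\<mu> by (rule P.prob_space_distr[OF fst_P])
  have tr': "trace_measurable ?\<mu> F"
  proof -
    have "sets (\<Pi>\<^sub>M i\<in>{..<n}. ?\<mu>) = sets (\<Pi>\<^sub>M i\<in>{..<n}. M)" for n :: nat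
      by (intro sets_PiM_cong) auto
    moreover from this have "space (\<Pi>\<^sub>M i\<in>{..<n}. ?\<mu>) = space (\<Pi>\<^sub>M i\<in>{..<n}. M)" for n :: nat
      by (intro sets_eq_imp_space_eq)
    ultimately show ?thesis using tr unfolding trace_measurable_def by simp
  qed
  interpret V: vc_class ?\<mu> F f d
  proof
    show "F \<subseteq> classifiers ?\<mu>" using F by (simp add: classifiers_def)
    show "card A \<le> d" if "A \<subseteq> space ?\<mu>" "finite A" "shatters F A" for A
      using vc that unfolding has_VC_dim_def by auto
  qed (fact fF tr')+
  have DIS_errors: "DIS M {h, f} = V.errors h" for h by (auto simp: DIS_def)
  have ball: "classifier_ball M P F f \<rho> = V.error_ball \<rho>" for \<rho>
  proof -
    have "Delta M P {h, f} = \<mu>.prob (V.errors h)" if "h \<in> F" for h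
      using Delta_eq[OF sets_P, of "{h, f}"] V.errors_measurable[OF that] DIS_errors[of h] by simp
    then show ?thesis by (auto simp: classifier_ball_def V.error_ball_def)
  qed
  have DIS_\<mu>: "DIS ?\<mu> H = DIS M H" for H by (simp add: DIS_def)
  have \<theta>1: "1 \<le> \<theta>" by (simp add: \<theta>_def disagreement_coeff_def)
  have L1: "1 \<le> L"
    using r0 by (simp add: L_def le_log_iff pos_le_divide_eq)
  have Ld: "0 \<le> ln (L / \<delta>)" using L1 \<delta> by (simp add: field_simps)
  have t0: "0 \<le> t" using Ld \<theta>1 by (simp add: t_def ln_mult)
  \<comment> \<open>As \<open>2 ^ k\<close> is an integer, being below the ceiling of
    \<open>1 / r\<close> already means being below \<open>1 / r\<close>: rounding costs
    nothing.\<close>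
  have small: "real (2 ^ k) \<le> 1 / r0" if "2 ^ k < m" for k
  proof -
    have "int (2 ^ k) < \<lceil>1 / r\<rceil>" using that by (simp add: m_def zless_nat_eq_int_zless)
    then have "real (2 ^ k) < 1 / r" by (simp add: less_ceiling_iff)
    also have "\<dots> \<le> 1 / r0" using r r0 by (intro divide_left_mono) auto
    finally show ?thesis by simp
  qed
  have "real (B_nhat P F m \<delta>) \<le> 100 * \<theta> * t * L"
  proof (cases "d = 0")
    case True
    \<comment> \<open>The general case divides by \<open>d\<close>. For \<open>d = 0\<close> no
      point is shattered, so all classifiers coincide with \<open>f\<close> on the space and the
      empty compression set suffices.\<close>
    have agree: "h x = f x" if "h \<in> F" "x \<in> space M" for h x
    proof (rule ccontr)
      assume ne: "h x \<noteq> f x"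
      have lab: "h x \<in> labels" "f x \<in> labels"
        using V.F_in_labels that fF by auto
      have "shatters F {x}"
        unfolding shatters_def
      proof (intro allI impI)
        fix B assume "B \<subseteq> {x}"
        show "\<exists>g\<in>F. \<forall>z\<in>{x}. g z = (if z \<in> B then 1 else - 1)"
        proof (cases "h x = (if x \<in> B then 1 else - 1)")
          case False
          then have "f x = (if x \<in> B then 1 else - 1)" using ne lab by (auto split: if_splits)
          then show ?thesis using fF by auto
        qed (use that in auto)
      qed
      then show False using V.shatters_card[of "{x}"] that True by simp
    qed
    have "B_nhat P F m \<delta> \<le> 0"
    proof (rule B_nhat_le[OF P sets_P F tr rl, of "space (\<Pi>\<^sub>M i\<in>{..<m}. ?\<mu>)"])
      have "prob_space (V.power_space m)" by (intro prob_space_PiM \<mu>.prob_space_axioms)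
      then show "1 - \<delta> \<le> measure (\<Pi>\<^sub>M i\<in>{..<m}. ?\<mu>) (space (\<Pi>\<^sub>M i\<in>{..<m}. ?\<mu>))"
        using \<delta> by (simp add: prob_space.prob_space)
      fix x \<omega> assume x: "x \<in> space (\<Pi>\<^sub>M i\<in>{..<m}. ?\<mu>)" and \<omega>: "\<And>i. i < m \<Longrightarrow> \<omega> i = (x i, f (x i))"
      have "nhat F (sample m \<omega>) \<le> card ({} \<inter> {..<m})"
        using V.power_space_component[OF x] by (intro nhat_le_card_queried[of m \<omega> x f, OF \<omega>] agree) auto
      then show "nhat F (sample m \<omega>) \<le> 0" by simp
    qed auto
    then show ?thesis using \<theta>1 t0 L1 by simp
  next
    case False
    then have d: "0 < d" by simp
    have td: "real d \<le> t"
    proof -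
      have "0 \<le> real d * ln \<theta>" using \<theta>1 by simp
      then show ?thesis using \<theta>1 Ld by (simp add: t_def ln_mult algebra_simps)
    qed
    have bdd: "bdd_above ((\<lambda>\<rho>. Delta M P (classifier_ball M P F f \<rho>) / \<rho>) ` {real d * r0<..})"
    proof (rule bdd_aboveI2)
      fix \<rho> assume "\<rho> \<in> {real d * r0<..}"
      then show "Delta M P (classifier_ball M P F f \<rho>) / \<rho> \<le> 1 / (real d * r0)"
        using d r0 by (intro frac_le) (auto simp: Delta_def)
    qed
    have D_prob: "\<mu>.prob (DIS ?\<mu> (V.error_ball (64 * t / 2 ^ k))) \<le> \<theta> * (64 * t / 2 ^ k)"
      if k: "2 ^ k < m" for k
    proof -
      let ?\<rho> = "64 * t / 2 ^ k"
      \<comment> \<open>The radius must exceed \<open>d * r0\<close> to take part in the supremum;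
        it does, by \<open>2 ^ k * r0 \<le> 1\<close> and \<open>d \<le> t\<close>.\<close>
      have "real d * r0 < ?\<rho>"
      proof -
        have "2 ^ k * r0 \<le> 1" using small[OF k] r0 by (simp add: field_simps)
        then have "real d * (2 ^ k * r0) \<le> real d * 1" by (intro mult_left_mono) auto
        also have "\<dots> < 64 * t" using td d by simp
        finally show ?thesis by (simp add: field_simps)
      qed
      moreover have "0 < ?\<rho>" using td d by simp
      ultimately have "Delta M P (classifier_ball M P F f ?\<rho>) / ?\<rho> \<le> \<theta>"
        unfolding \<theta>_def disagreement_coeff_def
        by (intro max.coboundedI1 cSUP_upper2[OF bdd, of ?\<rho>]) auto
      then have "Delta M P (classifier_ball M P F f ?\<rho>) \<le> \<theta> * ?\<rho>"
        using \<open>0 < ?\<rho>\<close> by (simp only: pos_divide_le_eq)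
      then show ?thesis
        using Delta_eq[OF sets_P DIS_meas[OF \<open>0 < ?\<rho>\<close>]] by (simp only: ball DIS_\<mu>)
    qed
    have epochs: "real k + 1 \<le> L" if "2 ^ k < m" for k
    proof -
      have "2 powr (real k + 1) \<le> 2 / r0"
        using small[OF that] by (simp add: powr_add powr_realpow)
      then show ?thesis using r0 by (simp add: L_def le_log_iff)
    qed
    have D_meas: "DIS ?\<mu> (V.error_ball \<rho>) \<in> \<mu>.events" if "0 < \<rho>" for \<rho>
      using DIS_meas[OF that] by (simp add: DIS_\<mu> ball)
    obtain G where G: "G \<in> sets (V.power_space m)" "1 - \<delta> \<le> measure (V.power_space m) G"
      "\<And>x \<omega>. x \<in> G \<Longrightarrow> (\<And>i. i < m \<Longrightarrow> \<omega> i = (x i, f (x i))) \<Longrightarrow>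
         real (nhat F (sample m \<omega>)) \<le> 100 * \<theta> * t * L"
      using V.nhat_le_with_high_prob[OF d \<theta>1 L1 \<delta>, of m] D_meas D_prob epochs
      unfolding t_def by blast
    have "B_nhat P F m \<delta> \<le> nat \<lfloor>100 * \<theta> * t * L\<rfloor>"
      by (rule B_nhat_le[OF P sets_P F tr rl G(1,2)]) (use G(3) in \<open>simp add: le_nat_floor\<close>)
    moreover have "0 \<le> 100 * \<theta> * t * L" using \<theta>1 t0 L1 by simp
    ultimately show ?thesis by linarith
  qed
  then show ?thesis unfolding m_def t_def .
qed

theorem theorem4:
  "\<exists>c::real. c > 0 \<and>
     (\<forall>(M :: 'a measure) (P :: ('a \<times> int) measure) (F :: ('a \<Rightarrow> int) set) (fstar :: 'a \<Rightarrow> int) (d :: nat).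
        prob_space P \<longrightarrow>
        sets P = sets (M \<Otimes>\<^sub>M count_space labels) \<longrightarrow>
        F \<subseteq> classifiers M \<longrightarrow>
        has_VC_dim M F d \<longrightarrow>
        fstar \<in> F \<longrightarrow>
        realizable_by M P fstar \<longrightarrow>
        trace_measurable M F \<longrightarrow>
        (\<forall>r>0. DIS M (classifier_ball M P F fstar r) \<in> sets M) \<longrightarrow>
        (\<forall>r0\<in>{0<..<1::real}. \<forall>\<delta>\<in>{0<..<1::real}.
           real (Max ((\<lambda>r. B_nhat P F (nat \<lceil>1 / r\<rceil>) \<delta>) ` {r0<..<1}))
             \<le> c * disagreement_coeff M P F fstar (real d * r0)
                 * (real d * ln (exp 1 * disagreement_coeff M P F fstar (real d * r0))
                    + ln (log 2 (2 / r0) / \<delta>))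
                 * log 2 (2 / r0)))"
proof (intro exI[of _ 100] conjI allI impI ballI)
  fix M :: "'a measure" and P :: "('a \<times> int) measure" and F :: "('a \<Rightarrow> int) set"
    and fstar :: "'a \<Rightarrow> int" and d :: nat and r0 \<delta> :: real
  assume H: "prob_space P" "sets P = sets (M \<Otimes>\<^sub>M count_space labels)" "F \<subseteq> classifiers M"
    "has_VC_dim M F d" "fstar \<in> F" "realizable_by M P fstar" "trace_measurable M F"
    "\<forall>r>0. DIS M (classifier_ball M P F fstar r) \<in> sets M"
    and r0: "r0 \<in> {0<..<1}" and \<delta>: "\<delta> \<in> {0<..<1}"
  let ?S = "(\<lambda>r. B_nhat P F (nat \<lceil>1 / r\<rceil>) \<delta>) ` {r0<..<1}"
  \<comment> \<open>\<open>Max\<close> is specified for finite nonempty sets only; although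
    \<open>r\<close> ranges over an interval, only finitely many sample sizes occur.\<close>
  have "?S \<subseteq> (\<lambda>n. B_nhat P F n \<delta>) ` {..nat \<lceil>1 / r0\<rceil>}"
  proof safe
    fix r assume r: "r \<in> {r0<..<1}"
    then have "1 / r \<le> 1 / r0" using r0 by (intro divide_left_mono) auto
    then show "B_nhat P F (nat \<lceil>1 / r\<rceil>) \<delta> \<in> (\<lambda>n. B_nhat P F n \<delta>) ` {..nat \<lceil>1 / r0\<rceil>}"
      using nat_mono[OF ceiling_mono[of "1 / r" "1 / r0"]] by (intro imageI) simp
  qed
  then have "finite ?S" by (rule finite_subset) simp
  moreover have "?S \<noteq> {}" using r0 by simp
  ultimately have "Max ?S \<in> ?S" by (rule Max_in)
  then obtain r where "r \<in> {r0<..<1}" "Max ?S = B_nhat P F (nat \<lceil>1 / r\<rceil>) \<delta>" by blast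
  then show "real (Max ?S) \<le> 100 * disagreement_coeff M P F fstar (real d * r0)
      * (real d * ln (exp 1 * disagreement_coeff M P F fstar (real d * r0)) + ln (log 2 (2 / r0) / \<delta>))
      * log 2 (2 / r0)"
    using B_nhat_bound[OF H(1-7), of r0 \<delta> r] H(8) r0 \<delta> by simp
qed simp

end
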